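(* For any normed space $(X,\|\cdot\|)$, $$\frac{T_{2}(X)}{2} \;\leq\; T_{\mathrm{KKL}}(X) \;\leq\; 2e\sqrt{2\pi}\; T_{2}(X).$$
   Context: $\{-1,1\}^n$ carries the uniform probability measure, and $\varepsilon=(\varepsilon_1,\dots,\varepsilon_n)$ denotes a uniformly distributed point of it. Write $\varepsilon^{\oplus j}=(\varepsilon_1,\dots,-\varepsilon_j,\dots,\varepsilon_n)$ (the $j$-th coordinate is flipped). $\log$ is the natural logarithm. Type 2 constant. For a normed space $(X,\|\cdot\|)$, $T_2(X)$ is the best (smallest) constant $T$ such that for all $n\ge 1$ and all $x_1,\dots,x_n\in X$, $$\mathbb{E}\Big\|\sum_{j=1}^n \varepsilon_j x_j\Big\|^2\le T^2\sum_{j=1}^n\|x_j\|^2 .$$ $T_2(X)=\infty$ if no finite $T$ works. $X$ is of (Rademacher) type 2 if $T_2(X)<\infty$. KKL constant. For a metric space $(X,d)$, $T_{\mathrm{KKL}}(X)$ is the best (smallest) constant $T$ such that for every $n\ge1$ and every $f:\{-1,1\}^n\to X$, $$\mathbb{E}\,d(f(\varepsilon),f(\varepsilon'))^2 \leq \frac{T^{2}}{\log\left(e\Big/\max\limits_{1\le k\le n}\frac{\mathbb{E}\,d(f(\varepsilon),f(\varepsilon^{\oplus k}))}{\sqrt{\mathbb{E}\,d(f(\varepsilon),f(\varepsilon^{\oplus k}))^2}}\right)}\, \sum_{j=1}^{n} \mathbb{E}\,d(f(\varepsilon),f(\varepsilon^{\oplus j}))^2 ,$$ where $\varepsilon'$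 is an independent copy of $\varepsilon$. $T_{\mathrm{KKL}}(X)=\infty$ if no finite $T$ works. In the maximum, a ratio $0/0$ is read as $0$ (such $k$ are ignored). If $f$ is constant, the inequality is regarded as trivially true (both sides are $0$). A normed space is regarded as a metric space with $d(x,y)=\|x-y\|$. *)

theory Defs
  imports "HOL-Probability.Probability"
begin

definition cube :: "nat \<Rightarrow> (nat \<Rightarrow> real) set" where
  "cube n = PiE {1..n} (\<lambda>_. {-1, 1})"

definition cube_pmf :: "nat \<Rightarrow> (nat \<Rightarrow> real) pmf" where
  "cube_pmf n = pmf_of_set (cube n)"

definition flip :: "nat \<Rightarrow> (nat \<Rightarrow> real) \<Rightarrow> (nat \<Rightarrow> real)" where
  "flip j x = x(j := - x j)"

definition type2_bound :: "'a::real_normed_vector itself \<Rightarrow> real \<Rightarrow> bool" where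
  "type2_bound (X :: 'a itself) T \<longleftrightarrow>
     (\<forall>n\<ge>1. \<forall>x :: nat \<Rightarrow> 'a.
        measure_pmf.expectation (cube_pmf n) (\<lambda>\<epsilon>. (norm (\<Sum>j=1..n. \<epsilon> j *\<^sub>R x j))\<^sup>2)
          \<le> T\<^sup>2 * (\<Sum>j=1..n. (norm (x j))\<^sup>2))"

text \<open>The infimum over the empty set is \<open>\<infinity>\<close> in \<^typ>\<open>ennreal\<close>.\<close>

definition T2 :: "'a::real_normed_vector itself \<Rightarrow> ennreal" where
  "T2 (X :: 'a itself) = Inf {ennreal T | T. T \<ge> 0 \<and> type2_bound X T}"

definition edge_L1 :: "nat \<Rightarrow> ((nat \<Rightarrow> real) \<Rightarrow> 'a::metric_space) \<Rightarrow> nat \<Rightarrow> real" where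
  "edge_L1 n f j = measure_pmf.expectation (cube_pmf n) (\<lambda>\<epsilon>. dist (f \<epsilon>) (f (flip j \<epsilon>)))"

definition edge_L2sq :: "nat \<Rightarrow> ((nat \<Rightarrow> real) \<Rightarrow> 'a::metric_space) \<Rightarrow> nat \<Rightarrow> real" where
  "edge_L2sq n f j =
     measure_pmf.expectation (cube_pmf n) (\<lambda>\<epsilon>. (dist (f \<epsilon>) (f (flip j \<epsilon>)))\<^sup>2)"

text \<open>
  A ratio \<open>0/0\<close> counts as \<open>0\<close> in the maximum; this is the value of division by zero here.
\<close>

definition max_edge_ratio :: "nat \<Rightarrow> ((nat \<Rightarrow> real) \<Rightarrow> 'a::metric_space) \<Rightarrow> real" where
  "max_edge_ratio n f = Max ((\<lambda>k. edge_L1 n f k / sqrt (edge_L2sq n f k)) ` {1..n})"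

text \<open>
  A map on the cube is represented by a function on all of \<^typ>\<open>nat \<Rightarrow> real\<close>; only its values
  on \<^term>\<open>cube n\<close> matter. Constant maps, for which the maximum vanishes and the right-hand side
  of the inequality has no meaning, satisfy it by convention and are therefore left out. For all
  other maps the maximum lies in \<open>(0, 1]\<close>, so that the logarithm is at least \<open>1\<close>.
\<close>

definition kkl_bound :: "'a::metric_space itself \<Rightarrow> real \<Rightarrow> bool" where
  "kkl_bound (X :: 'a itself) T \<longleftrightarrow>
     (\<forall>n\<ge>1. \<forall>f :: (nat \<Rightarrow> real) \<Rightarrow> 'a. \<not> f constant_on cube n \<longrightarrow>
        measure_pmf.expectation (pair_pmf (cube_pmf n) (cube_pmf n))
            (\<lambda>(\<epsilon>, \<epsilon>'). (dist (f \<epsilon>) (f \<epsilon>'))\<^sup>2)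
          \<le> T\<^sup>2 / ln (exp 1 / max_edge_ratio n f) * (\<Sum>j=1..n. edge_L2sq n f j))"

definition T_KKL :: "'a::metric_space itself \<Rightarrow> ennreal" where
  "T_KKL (X :: 'a itself) = Inf {ennreal T | T. T \<ge> 0 \<and> kkl_bound X T}"

end

theory Submission
  imports Defs
begin

text \<open>
  The lower bound is the inequality of \<^const>\<open>kkl_bound\<close> for a linear map
  \<open>f \<epsilon> = (\<Sum>j. \<epsilon>\<^sub>j x\<^sub>j)\<close>: every edge difference has the constant length \<open>2 \<parallel>x\<^sub>j\<parallel>\<close>, so that,
  unless all \<open>x\<^sub>j\<close> vanish, the maximal ratio is \<open>1\<close> and the logarithm is \<open>1\<close>, while averaging over the independent copy only
  decreases the left-hand side (Jensen) to \<open>E \<parallel>f \<epsilon>\<parallel>\<^sup>2\<close>.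

  For the upper bound, let \<open>P\<^sub>\<rho> f x\<close> be the mean of \<open>f\<close> at a random point whose coordinates are
  independent and correlated with those of \<open>x\<close> by \<open>\<rho>\<close> (\<open>noise\<close> below). The path
  \<open>\<rho> \<mapsto> P\<^bsub>\<rho>\<^sup>2\<^esub> f\<close> leads from the mean of \<open>f\<close> at \<open>\<rho> = 0\<close> to \<open>f\<close> at \<open>\<rho> = 1\<close>, and since
  \<open>P\<^bsub>\<rho>\<^sup>2\<^esub> = P\<^sub>\<rho> P\<^sub>\<rho>\<close>, its velocity at \<open>x\<close> is
  \<open>2 / (1 - \<rho>\<^sup>2) E (\<Sum>i. (x\<^sub>i y\<^sub>i - \<rho>) P\<^sub>\<rho> D\<^sub>i f y)\<close>, where \<open>y\<close> is the noisy copy of \<open>x\<close> and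
  \<open>D\<^sub>i\<close> halves the difference along the \<open>i\<close>-th edge (\<open>noise_square_has_derivative\<close>). If \<open>y\<close> is
  held fixed instead of \<open>x\<close>, the factors \<open>x\<^sub>i y\<^sub>i - \<rho>\<close> are independent and centred with variance
  \<open>1 - \<rho>\<^sup>2\<close>, so symmetrization and type 2 bound the \<open>L\<^sup>2\<close>-norm of the velocity by
  \<open>2 \<surd>2 T (1 - \<rho>\<^sup>2)\<^bsup>-1/2\<^esup> (\<Sum>i. \<parallel>P\<^sub>\<rho> D\<^sub>i f\<parallel>\<^sup>2)\<^bsup>1/2\<^esup>\<close> (\<open>avg_dnoise_square_le\<close>). This idea is due to
  Ivanisvili, van Handel and Volberg; used with \<open>\<parallel>P\<^sub>\<rho> D\<^sub>i f\<parallel> \<le> \<parallel>D\<^sub>i f\<parallel>\<close> it gives Enflo type 2.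

  The logarithm comes from smoothing. Let \<open>r\<close> be the maximal ratio and \<open>L = ln (1 / r)\<close>. Bonami's
  inequality from \<open>L\<^sup>2\<close> to \<open>L\<^sup>4\<close> at \<open>\<rho>\<^sup>2 \<le> 1/3\<close> dualizes to
  \<open>\<parallel>P\<^sub>\<rho> g\<parallel>\<^sub>2\<^sup>2 \<le> \<parallel>g\<parallel>\<^sub>1 \<parallel>g\<parallel>\<^sub>2\<close>. For larger \<open>\<rho>\<close> one descends by repeated squaring of \<open>\<rho>\<close>,
  using \<open>\<parallel>P\<^sub>\<rho> g\<parallel>\<^sub>2\<^sup>2 \<le> \<parallel>g\<parallel>\<^sub>2 \<parallel>P\<^bsub>\<rho>\<^sup>2\<^esub> g\<parallel>\<^sub>2\<close>; each squaring halves the exponent of the ratio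
  (\<open>noise_square_le_powr\<close>). This saves a factor \<open>e\<^bsup>-L (1 - \<rho>\<^sup>2) / 8\<^esup>\<close>, which is at most
  \<open>1 / (1 + L (1 - \<rho>\<^sup>2) / 8)\<close>, in the velocity. The resulting bound has an elementary primitive,
  and its integral over \<open>[0, 1]\<close> is \<open>(\<pi> / 2) / \<surd>(1 + L / 8)\<close>. Altogether
  \<open>E \<parallel>f \<epsilon> - f \<epsilon>'\<parallel>\<^sup>2 \<le> 2 \<pi>\<^sup>2 T\<^sup>2 / (1 + L / 8)\<close> times the sum of the edge energies, and this suffices
  because \<open>2 \<pi> \<le> e\<^sup>2\<close>.
\<close>

section \<open>Sums over the discrete cube\<close>

text \<open>
  The cube is taken over an arbitrary index set, because Bonami's inequality is proved by adding
  one coordinate at a time.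
\<close>

definition signs :: "nat set \<Rightarrow> (nat \<Rightarrow> real) set" where
  "signs I = PiE I (\<lambda>_. {-1, 1})"

lemma finite_signs [simp]: "finite I \<Longrightarrow> finite (signs I)"
  by (simp add: signs_def finite_PiE)

lemma card_signs: "finite I \<Longrightarrow> card (signs I) = 2 ^ card I"
  by (simp add: signs_def card_PiE numeral_2_eq_2)

lemma signs_cases: "x \<in> signs I \<Longrightarrow> i \<in> I \<Longrightarrow> x i = 1 \<or> x i = -1"
  by (auto simp: signs_def PiE_iff)

lemma signs_square: "x \<in> signs I \<Longrightarrow> i \<in> I \<Longrightarrow> x i * x i = 1"
  using signs_cases[of x I i] by auto

lemma flip_in_signs: "i \<in> I \<Longrightarrow> x \<in> signs I \<Longrightarrow> flip i x \<in> signs I"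
  by (auto simp: flip_def signs_def PiE_iff extensional_def)

lemma flip_flip [simp]: "flip i (flip i x) = x"
  by (auto simp: flip_def)

lemma sum_flip:
  assumes "i \<in> I"
  shows "(\<Sum>x\<in>signs I. g (flip i x)) = (\<Sum>x\<in>signs I. g x)"
  by (rule sum.reindex_bij_witness[where i = "flip i" and j = "flip i"])
     (use assms in \<open>auto simp: flip_in_signs\<close>)

lemma sum_signs_insert:
  fixes g :: "(nat \<Rightarrow> real) \<Rightarrow> 'a::comm_monoid_add"
  assumes "finite I" "i \<notin> I"
  shows "(\<Sum>x\<in>signs (insert i I). g x) = (\<Sum>x\<in>signs I. g (x(i := 1)) + g (x(i := -1)))"
proof -
  have inj: "inj_on (\<lambda>(s, x). x(i := s)) ({-1, 1} \<times> signs I)"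
    unfolding signs_def by (rule inj_combinator) (use assms in auto)
  have "(\<Sum>x\<in>signs (insert i I). g x) = (\<Sum>(s, x)\<in>{-1, 1} \<times> signs I. g (x(i := s)))"
    unfolding signs_def PiE_insert_eq
    by (subst sum.reindex) (use inj in \<open>auto simp: signs_def case_prod_unfold\<close>)
  also have "\<dots> = (\<Sum>s\<in>{-1, 1}. \<Sum>x\<in>signs I. g (x(i := s)))"
    by (rule sum.cartesian_product[symmetric])
  also have "\<dots> = (\<Sum>x\<in>signs I. g (x(i := 1)) + g (x(i := -1)))"
    by (simp add: sum.distrib add.commute)
  finally show ?thesis .
qed

lemma sum_signs_prod:
  fixes h :: "nat \<Rightarrow> real \<Rightarrow> real"
  assumes "finite I"
  shows "(\<Sum>x\<in>signs I. \<Prod>i\<in>I. h i (x i)) = (\<Prod>i\<in>I. h i 1 + h i (-1))"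
  using prod_sum_PiE[of I "\<lambda>_. {-1, 1}" h] assms
  by (simp add: signs_def add.commute)

definition avg :: "nat set \<Rightarrow> ((nat \<Rightarrow> real) \<Rightarrow> real) \<Rightarrow> real" where
  "avg I g = (\<Sum>x\<in>signs I. g x) / 2 ^ card I"

lemma avg_cong: "(\<And>x. x \<in> signs I \<Longrightarrow> g x = h x) \<Longrightarrow> avg I g = avg I h"
  by (simp add: avg_def cong: sum.cong)

lemma avg_mono: "(\<And>x. x \<in> signs I \<Longrightarrow> g x \<le> h x) \<Longrightarrow> avg I g \<le> avg I h"
  by (simp add: avg_def divide_right_mono sum_mono)

lemma avg_nonneg: "(\<And>x. x \<in> signs I \<Longrightarrow> 0 \<le> g x) \<Longrightarrow> 0 \<le> avg I g"
  by (simp add: avg_def sum_nonneg)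

lemma avg_add: "avg I (\<lambda>x. g x + h x) = avg I g + avg I h"
  by (simp add: avg_def sum.distrib add_divide_distrib)

lemma avg_cmult: "avg I (\<lambda>x. c * g x) = c * avg I g"
  by (simp add: avg_def sum_distrib_left)

lemma avg_const: "finite I \<Longrightarrow> avg I (\<lambda>_. c) = c"
  by (simp add: avg_def card_signs)

lemma avg_sum: "avg I (\<lambda>x. \<Sum>j\<in>J. g j x) = (\<Sum>j\<in>J. avg I (g j))"
  unfolding avg_def by (subst sum.swap) (simp add: sum_divide_distrib)

lemma avg_insert:
  assumes "finite I" "i \<notin> I"
  shows "avg (insert i I) g = avg I (\<lambda>x. (g (x(i := 1)) + g (x(i := -1))) / 2)"
  using assms by (simp add: avg_def sum_signs_insert sum_divide_distrib)

lemma avg_Cauchy_Schwarz: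
  "(avg I (\<lambda>x. g x * h x))\<^sup>2 \<le> avg I (\<lambda>x. (g x)\<^sup>2) * avg I (\<lambda>x. (h x)\<^sup>2)"
  using Cauchy_Schwarz_ineq_sum[of g h "signs I"]
  by (simp add: avg_def power_divide divide_right_mono power2_eq_square[of "2 ^ card I"])

lemma norm_convex_combination_square_le:
  fixes v :: "'b \<Rightarrow> 'a::real_normed_vector"
  assumes w: "\<And>i. i \<in> A \<Longrightarrow> 0 \<le> w i" and one: "sum w A = 1"
  shows "(norm (\<Sum>i\<in>A. w i *\<^sub>R v i))\<^sup>2 \<le> (\<Sum>i\<in>A. w i * (norm (v i))\<^sup>2)"
proof -
  have "norm (\<Sum>i\<in>A. w i *\<^sub>R v i) \<le> (\<Sum>i\<in>A. sqrt (w i) * (sqrt (w i) * norm (v i)))"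
    by (rule sum_norm_le) (use w in \<open>simp flip: mult.assoc\<close>)
  then have "(norm (\<Sum>i\<in>A. w i *\<^sub>R v i))\<^sup>2
      \<le> (\<Sum>i\<in>A. sqrt (w i) * (sqrt (w i) * norm (v i)))\<^sup>2"
    by (rule power_mono) simp
  also have "\<dots> \<le> (\<Sum>i\<in>A. (sqrt (w i))\<^sup>2) * (\<Sum>i\<in>A. (sqrt (w i) * norm (v i))\<^sup>2)"
    by (rule Cauchy_Schwarz_ineq_sum)
  also have "\<dots> = (\<Sum>i\<in>A. w i * (norm (v i))\<^sup>2)"
    using w one by (simp add: power_mult_distrib)
  finally show ?thesis .
qed

section \<open>The noise operator\<close>

text \<open>
  The probability of \<open>y\<close> when each coordinate independently satisfies \<open>E y\<^sub>i = \<rho> x\<^sub>i\<close>. For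
  \<open>\<rho> = e\<^bsup>-t\<^esup>\<close> these are the transition probabilities of the heat semigroup on the cube.
\<close>

definition kernel :: "nat set \<Rightarrow> real \<Rightarrow> (nat \<Rightarrow> real) \<Rightarrow> (nat \<Rightarrow> real) \<Rightarrow> real" where
  "kernel I \<rho> x y = (\<Prod>i\<in>I. (1 + \<rho> * x i * y i) / 2)"

definition noise ::
  "nat set \<Rightarrow> real \<Rightarrow> ((nat \<Rightarrow> real) \<Rightarrow> 'a::real_normed_vector) \<Rightarrow> (nat \<Rightarrow> real) \<Rightarrow> 'a" where
  "noise I \<rho> f x = (\<Sum>y\<in>signs I. kernel I \<rho> x y *\<^sub>R f y)"

lemma kernel_commute: "kernel I \<rho> x y = kernel I \<rho> y x"
  by (simp add: kernel_def mult_ac)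

lemma kernel_nonneg:
  assumes "0 \<le> \<rho>" "\<rho> \<le> 1" "x \<in> signs I" "y \<in> signs I"
  shows "0 \<le> kernel I \<rho> x y"
  unfolding kernel_def
proof (rule prod_nonneg)
  fix i assume "i \<in> I"
  then show "0 \<le> (1 + \<rho> * x i * y i) / 2"
    using signs_cases[OF assms(3) \<open>i \<in> I\<close>] signs_cases[OF assms(4) \<open>i \<in> I\<close>] assms(1,2) by auto
qed

text \<open>
  The sum over \<open>z\<close> factorizes, and in one coordinate correlations multiply. The identity holds for all real \<open>\<sigma>\<close> and
  \<open>\<tau>\<close>, and can therefore be differentiated in either parameter.
\<close>

lemma kernel_compose:
  assumes "finite I"
  shows "(\<Sum>z\<in>signs I. kernel I \<sigma> x z * kernel I \<tau> z y) = kernel I (\<sigma> * \<tau>) x y"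
proof -
  have "(\<Sum>z\<in>signs I. kernel I \<sigma> x z * kernel I \<tau> z y)
      = (\<Sum>z\<in>signs I. \<Prod>i\<in>I. (1 + \<sigma> * x i * z i) / 2 * ((1 + \<tau> * z i * y i) / 2))"
    unfolding kernel_def by (simp only: prod.distrib)
  also have "\<dots> = (\<Prod>i\<in>I. (1 + \<sigma> * x i * 1) / 2 * ((1 + \<tau> * 1 * y i) / 2)
      + (1 + \<sigma> * x i * (-1)) / 2 * ((1 + \<tau> * (-1) * y i) / 2))"
    by (rule sum_signs_prod[OF assms])
  also have "\<dots> = kernel I (\<sigma> * \<tau>) x y"
    unfolding kernel_def by (rule prod.cong) (auto simp: field_simps)
  finally show ?thesis .
qed

lemma sum_kernel:
  assumes "finite I"
  shows "(\<Sum>y\<in>signs I. kernel I \<rho> x y) = 1"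
proof -
  have "(\<Sum>y\<in>signs I. kernel I \<rho> x y)
      = (\<Prod>i\<in>I. (1 + \<rho> * x i * 1) / 2 + (1 + \<rho> * x i * (-1)) / 2)"
    unfolding kernel_def by (rule sum_signs_prod[OF assms])
  also have "\<dots> = 1" by (simp add: field_simps)
  finally show ?thesis .
qed

lemma kernel_zero: "kernel I 0 x y = 1 / 2 ^ card I"
  by (simp add: kernel_def power_one_over)

lemma kernel_one:
  assumes "finite I" "x \<in> signs I" "y \<in> signs I"
  shows "kernel I 1 x y = (if x = y then 1 else 0)"
proof (cases "x = y")
  case True
  have "kernel I 1 x x = (\<Prod>i\<in>I. 1)"
    unfolding kernel_def by (rule prod.cong) (use signs_square[OF assms(2)] in auto)
  with True show ?thesis by simp
next
  case False
  then obtain i where i: "i \<in> I" "x i \<noteq> y i"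
    using assms(2,3) unfolding signs_def by (metis PiE_ext)
  then have "x i * y i = -1"
    using signs_cases[OF assms(2) i(1)] signs_cases[OF assms(3) i(1)] by auto
  with i assms(1) False show ?thesis
    by (auto simp: kernel_def intro!: bexI[of _ i])
qed

lemma noise_one:
  assumes "finite I" "x \<in> signs I"
  shows "noise I 1 f x = f x"
proof -
  have "noise I 1 f x = (\<Sum>y\<in>signs I. if x = y then f y else 0)"
    unfolding noise_def by (rule sum.cong) (use assms in \<open>auto simp: kernel_one\<close>)
  then show ?thesis using assms by simp
qed

lemma noise_compose:
  assumes "finite I"
  shows "noise I \<sigma> (noise I \<tau> f) x = noise I (\<sigma> * \<tau>) f x"
proof -
  have "noise I \<sigma> (noise I \<tau> f) x
      = (\<Sum>z\<in>signs I. \<Sum>y\<in>signs I. (kernel I \<sigma> x z * kernel I \<tau> z y) *\<^sub>R f y)"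
    by (simp add: noise_def scaleR_sum_right)
  also have "\<dots> = (\<Sum>y\<in>signs I. (\<Sum>z\<in>signs I. kernel I \<sigma> x z * kernel I \<tau> z y) *\<^sub>R f y)"
    by (subst sum.swap) (simp add: scaleR_sum_left)
  finally show ?thesis
    using assms by (simp add: kernel_compose noise_def)
qed

lemma noise_self_adjoint:
  fixes g h :: "(nat \<Rightarrow> real) \<Rightarrow> real"
  shows "avg I (\<lambda>x. noise I \<rho> g x * h x) = avg I (\<lambda>x. g x * noise I \<rho> h x)"
proof -
  have "(\<Sum>x\<in>signs I. noise I \<rho> g x * h x)
      = (\<Sum>x\<in>signs I. \<Sum>y\<in>signs I. kernel I \<rho> x y * g y * h x)"
    by (simp add: noise_def sum_distrib_right)
  also have "\<dots> = (\<Sum>y\<in>signs I. g y * noise I \<rho> h y)"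
    by (subst sum.swap)
       (simp add: noise_def sum_distrib_left mult_ac kernel_commute[of I \<rho>])
  finally show ?thesis by (simp add: avg_def)
qed

lemma norm_noise_le:
  assumes "0 \<le> \<rho>" "\<rho> \<le> 1" "x \<in> signs I"
  shows "norm (noise I \<rho> f x) \<le> noise I \<rho> (\<lambda>y. norm (f y)) x"
  unfolding noise_def real_scaleR_def
  by (rule sum_norm_le) (use assms kernel_nonneg in auto)

lemma avg_noise_square:
  fixes g :: "(nat \<Rightarrow> real) \<Rightarrow> real"
  assumes "finite I"
  shows "avg I (\<lambda>x. (noise I \<rho> g x)\<^sup>2) = avg I (\<lambda>x. g x * noise I (\<rho>\<^sup>2) g x)"
  using noise_self_adjoint[of I \<rho> g "noise I \<rho> g"] assms
  by (simp add: noise_compose power2_eq_square)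

text \<open>
  Splitting \<open>g\<close> into its even and odd parts in the new coordinate: noise leaves the even part alone
  and multiplies the odd part by \<open>\<rho>\<close>.
\<close>

section \<open>Smoothing of nonnegative functions\<close>

lemma noise_insert:
  fixes g :: "(nat \<Rightarrow> real) \<Rightarrow> real"
  assumes "finite I" "i \<notin> I"
  shows "noise (insert i I) \<rho> g (x(i := s))
    = noise I \<rho> (\<lambda>y. (g (y(i := 1)) + g (y(i := -1))) / 2) x
      + \<rho> * s * noise I \<rho> (\<lambda>y. (g (y(i := 1)) - g (y(i := -1))) / 2) x"
proof -
  have K: "kernel (insert i I) \<rho> (x(i := s)) (y(i := t)) = (1 + \<rho> * s * t) / 2 * kernel I \<rho> x y" for y t
  proof -
    have "(\<Prod>j\<in>I. (1 + \<rho> * (x(i := s)) j * (y(i := t)) j) / 2) = (\<Prod>j\<in>I. (1 + \<rho> * x j * y j) / 2)"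
      using assms by (intro prod.cong) auto
    then show ?thesis using assms by (simp add: kernel_def)
  qed
  have "noise (insert i I) \<rho> g (x(i := s)) = (\<Sum>y\<in>signs I.
      kernel I \<rho> x y * ((g (y(i := 1)) + g (y(i := -1))) / 2)
      + \<rho> * s * (kernel I \<rho> x y * ((g (y(i := 1)) - g (y(i := -1))) / 2)))"
    unfolding noise_def sum_signs_insert[OF assms] K
    by (rule sum.cong) (auto simp: field_simps)
  then show ?thesis
    by (simp add: noise_def sum.distrib sum_distrib_left)
qed

text \<open>
  Hypercontractivity from \<open>L\<^sup>2\<close> to \<open>L\<^sup>4\<close>. With \<open>a\<close> and \<open>b\<close> the noisy even and odd parts in the new
  coordinate, the odd powers of \<open>b\<close> cancel in the mean of \<open>(a \<plusminus> \<rho> b)\<^sup>4\<close>, and \<open>3 \<rho>\<^sup>2 \<le> 1\<close> turns the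
  mixed coefficient \<open>6 \<rho>\<^sup>2\<close> into the \<open>2\<close> of a complete square. The mixed term itself is controlled
  by Cauchy-Schwarz and the two induction hypotheses.
\<close>

lemma Bonami:
  fixes g :: "(nat \<Rightarrow> real) \<Rightarrow> real"
  assumes "finite I" and \<rho>: "3 * \<rho>\<^sup>2 \<le> 1"
  shows "avg I (\<lambda>x. (noise I \<rho> g x) ^ 4) \<le> (avg I (\<lambda>x. (g x)\<^sup>2))\<^sup>2"
  using assms(1)
proof (induction I arbitrary: g rule: finite_induct)
  case empty
  show ?case by (simp add: avg_def noise_def kernel_def signs_def)
next
  case (insert i I)
  define u v where "u = (\<lambda>y. (g (y(i := 1)) + g (y(i := -1))) / 2)"
    and "v = (\<lambda>y. (g (y(i := 1)) - g (y(i := -1))) / 2)"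
  define a b where "a = noise I \<rho> u" and "b = noise I \<rho> v"
  define U V where "U = avg I (\<lambda>x. (u x)\<^sup>2)" and "V = avg I (\<lambda>x. (v x)\<^sup>2)"
  have U0: "0 \<le> U" and V0: "0 \<le> V"
    by (simp_all add: U_def V_def avg_nonneg)
  have a4: "avg I (\<lambda>x. (a x) ^ 4) \<le> U\<^sup>2" and b4: "avg I (\<lambda>x. (b x) ^ 4) \<le> V\<^sup>2"
    using insert.IH by (simp_all add: a_def b_def U_def V_def)
  have "(avg I (\<lambda>x. (a x)\<^sup>2 * (b x)\<^sup>2))\<^sup>2 \<le> avg I (\<lambda>x. ((a x)\<^sup>2)\<^sup>2) * avg I (\<lambda>x. ((b x)\<^sup>2)\<^sup>2)"
    by (rule avg_Cauchy_Schwarz)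
  also have "\<dots> \<le> U\<^sup>2 * V\<^sup>2"
    using a4 b4 by (intro mult_mono) (auto simp: avg_nonneg)
  finally have "(avg I (\<lambda>x. (a x)\<^sup>2 * (b x)\<^sup>2))\<^sup>2 \<le> (U * V)\<^sup>2"
    by (simp add: power_mult_distrib)
  then have ab: "avg I (\<lambda>x. (a x)\<^sup>2 * (b x)\<^sup>2) \<le> U * V"
    by (rule power2_le_imp_le) (simp add: U0 V0)
  have point: "((a x + \<rho> * 1 * b x) ^ 4 + (a x + \<rho> * (-1) * b x) ^ 4) / 2
      \<le> (a x) ^ 4 + (2 * ((a x)\<^sup>2 * (b x)\<^sup>2) + (b x) ^ 4)" for x
  proof -
    have eq: "((a x + \<rho> * 1 * b x) ^ 4 + (a x + \<rho> * (-1) * b x) ^ 4) / 2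
        = (a x) ^ 4 + 6 * \<rho>\<^sup>2 * ((a x)\<^sup>2 * (b x)\<^sup>2) + (\<rho>\<^sup>2)\<^sup>2 * (b x) ^ 4"
      by (simp add: power2_eq_square power4_eq_xxxx algebra_simps)
    have "(\<rho>\<^sup>2)\<^sup>2 \<le> 1" using \<rho> power_le_one[of "\<rho>\<^sup>2" 2] by simp
    then have "(\<rho>\<^sup>2)\<^sup>2 * (b x) ^ 4 \<le> 1 * (b x) ^ 4"
      by (rule mult_right_mono) simp
    moreover have "6 * \<rho>\<^sup>2 * ((a x)\<^sup>2 * (b x)\<^sup>2) \<le> 2 * ((a x)\<^sup>2 * (b x)\<^sup>2)"
      using \<rho> by (intro mult_right_mono) auto
    ultimately show ?thesis unfolding eq by linarith
  qed
  have "avg (insert i I) (\<lambda>x. (noise (insert i I) \<rho> g x) ^ 4)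
      = avg I (\<lambda>x. ((a x + \<rho> * 1 * b x) ^ 4 + (a x + \<rho> * (-1) * b x) ^ 4) / 2)"
    unfolding avg_insert[OF insert.hyps] noise_insert[OF insert.hyps] a_def b_def u_def v_def ..
  also have "\<dots> \<le> avg I (\<lambda>x. (a x) ^ 4 + (2 * ((a x)\<^sup>2 * (b x)\<^sup>2) + (b x) ^ 4))"
    by (rule avg_mono) (rule point)
  also have "\<dots> = avg I (\<lambda>x. (a x) ^ 4) + (2 * avg I (\<lambda>x. (a x)\<^sup>2 * (b x)\<^sup>2) + avg I (\<lambda>x. (b x) ^ 4))"
    by (simp add: avg_add avg_cmult)
  also have "\<dots> \<le> U\<^sup>2 + (2 * (U * V) + V\<^sup>2)"
    using a4 b4 ab by linarith
  also have "\<dots> = (U + V)\<^sup>2" by (simp add: power2_sum)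
  also have "U + V = avg (insert i I) (\<lambda>x. (g x)\<^sup>2)"
    using insert.hyps
    by (simp add: U_def V_def avg_insert flip: avg_add)
       (intro avg_cong, simp add: u_def v_def power2_eq_square field_simps)
  finally show ?case .
qed

text \<open>
  The dual form of Bonami's inequality: by self-adjointness the left-hand side is the pairing of
  \<open>g\<close> with \<open>h = P\<^sub>\<rho> P\<^sub>\<rho> g\<close>. Two applications of Cauchy-Schwarz separate \<open>\<parallel>g\<parallel>\<^sub>1\<close>, \<open>\<parallel>g\<parallel>\<^sub>2\<close> and
  \<open>\<parallel>h\<parallel>\<^sub>4\<close>, and the last norm is at most \<open>\<parallel>P\<^sub>\<rho> g\<parallel>\<^sub>2\<close>.
\<close>

lemma noise_square_le_L1_L2:
  fixes g :: "(nat \<Rightarrow> real) \<Rightarrow> real"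
  assumes "finite I" "3 * \<rho>\<^sup>2 \<le> 1" and g: "\<And>x. x \<in> signs I \<Longrightarrow> 0 \<le> g x"
  shows "avg I (\<lambda>x. (noise I \<rho> g x)\<^sup>2) \<le> avg I g * sqrt (avg I (\<lambda>x. (g x)\<^sup>2))"
proof -
  define N where "N = avg I (\<lambda>x. (noise I \<rho> g x)\<^sup>2)"
  define h where "h = noise I \<rho> (noise I \<rho> g)"
  define A B where "A = avg I g" and "B = sqrt (avg I (\<lambda>x. (g x)\<^sup>2))"
  have B2: "B\<^sup>2 = avg I (\<lambda>x. (g x)\<^sup>2)"
    unfolding B_def by (rule real_sqrt_pow2) (simp add: avg_nonneg)
  have pos: "0 \<le> N" "0 \<le> A" "0 \<le> B"
    by (auto simp: N_def A_def B_def avg_nonneg g)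
  have N: "N = avg I (\<lambda>x. g x * h x)"
    using noise_self_adjoint[of I \<rho> g "noise I \<rho> g"]
    by (simp add: N_def h_def power2_eq_square)
  have "(avg I (\<lambda>x. g x * (h x)\<^sup>2))\<^sup>2 \<le> avg I (\<lambda>x. (g x)\<^sup>2) * avg I (\<lambda>x. ((h x)\<^sup>2)\<^sup>2)"
    by (rule avg_Cauchy_Schwarz)
  also have "\<dots> \<le> B\<^sup>2 * N\<^sup>2"
    using Bonami[OF assms(1,2), of "noise I \<rho> g"]
    by (intro mult_mono) (auto simp: B2 N_def h_def avg_nonneg)
  finally have "(avg I (\<lambda>x. g x * (h x)\<^sup>2))\<^sup>2 \<le> (B * N)\<^sup>2"
    by (simp add: power_mult_distrib)
  then have gh: "avg I (\<lambda>x. g x * (h x)\<^sup>2) \<le> B * N"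
    by (rule power2_le_imp_le) (simp add: pos)
  have "N\<^sup>2 = (avg I (\<lambda>x. sqrt (g x) * (sqrt (g x) * h x)))\<^sup>2"
    unfolding N by (intro arg_cong[of _ _ "\<lambda>t. t\<^sup>2"] avg_cong) (simp add: g flip: mult.assoc)
  also have "\<dots> \<le> avg I (\<lambda>x. (sqrt (g x))\<^sup>2) * avg I (\<lambda>x. (sqrt (g x) * h x)\<^sup>2)"
    by (rule avg_Cauchy_Schwarz)
  also have "\<dots> = A * avg I (\<lambda>x. g x * (h x)\<^sup>2)"
    unfolding A_def by (intro arg_cong2[of _ _ _ _ "(*)"] avg_cong) (simp_all add: g power_mult_distrib)
  also have "\<dots> \<le> A * (B * N)"
    using gh pos by (intro mult_left_mono) auto
  finally have "N * N \<le> (A * B) * N" by (simp add: power2_eq_square mult_ac)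
  then have "N \<le> A * B"
    using pos by (cases "N = 0") auto
  then show ?thesis by (simp add: N_def A_def B_def)
qed

text \<open>
  One step from \<open>\<rho>\<^sup>2\<close> to \<open>\<rho>\<close> is the Cauchy-Schwarz inequality applied to
  \<open>\<parallel>P\<^sub>\<rho> g\<parallel>\<^sub>2\<^sup>2 = \<langle>g, P\<^bsub>\<rho>\<^sup>2\<^esub> g\<rangle>\<close>. It replaces log-convexity of \<open>\<parallel>P\<^sub>\<rho> g\<parallel>\<^sub>2\<close> in \<open>ln \<rho>\<close>, so that no Fourier
  expansion is needed.
\<close>

lemma noise_square_le_dyadic:
  fixes g :: "(nat \<Rightarrow> real) \<Rightarrow> real"
  assumes "finite I" and g: "\<And>x. x \<in> signs I \<Longrightarrow> 0 \<le> g x"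
    and r: "0 < r" "avg I g \<le> r * sqrt (avg I (\<lambda>x. (g x)\<^sup>2))"
    and "3 * (\<rho> ^ 2 ^ k)\<^sup>2 \<le> 1"
  shows "avg I (\<lambda>x. (noise I \<rho> g x)\<^sup>2) \<le> avg I (\<lambda>x. (g x)\<^sup>2) * r powr (1 / 2 ^ k)"
  using assms(5)
proof (induction k arbitrary: \<rho>)
  case 0
  have "avg I (\<lambda>x. (noise I \<rho> g x)\<^sup>2) \<le> avg I g * sqrt (avg I (\<lambda>x. (g x)\<^sup>2))"
    using 0 by (intro noise_square_le_L1_L2 assms) simp_all
  also have "\<dots> \<le> r * sqrt (avg I (\<lambda>x. (g x)\<^sup>2)) * sqrt (avg I (\<lambda>x. (g x)\<^sup>2))"
    by (intro mult_right_mono r) (simp add: avg_nonneg)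
  also have "\<dots> = avg I (\<lambda>x. (g x)\<^sup>2) * r"
    by (simp add: avg_nonneg mult_ac)
  finally show ?case using r by simp
next
  case (Suc k)
  define G where "G = avg I (\<lambda>x. (g x)\<^sup>2)"
  have G0: "0 \<le> G" by (simp add: G_def avg_nonneg)
  have IH: "avg I (\<lambda>x. (noise I (\<rho>\<^sup>2) g x)\<^sup>2) \<le> G * r powr (1 / 2 ^ k)"
    unfolding G_def by (rule Suc.IH) (use Suc.prems in \<open>simp flip: power_mult\<close>)
  have "(avg I (\<lambda>x. (noise I \<rho> g x)\<^sup>2))\<^sup>2 \<le> G * avg I (\<lambda>x. (noise I (\<rho>\<^sup>2) g x)\<^sup>2)"
    using avg_Cauchy_Schwarz[of I g "noise I (\<rho>\<^sup>2) g"]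
    by (simp add: avg_noise_square[OF assms(1), of \<rho>] G_def)
  also have "\<dots> \<le> G * (G * r powr (1 / 2 ^ k))"
    using IH G0 by (rule mult_left_mono)
  also have "\<dots> = (G * r powr (1 / 2 ^ Suc k))\<^sup>2"
    using r by (simp add: power2_eq_square mult_ac flip: powr_add)
  finally show ?case
    unfolding G_def[symmetric] by (rule power2_le_imp_le) (simp add: G0)
qed

text \<open>
  The least number \<open>k\<close> of squarings that reaches the range of Bonami's inequality satisfies
  \<open>2\<^sup>k \<le> 4 / (1 - \<rho>\<^sup>2)\<close>: otherwise \<open>k - 1\<close> squarings would already suffice.
\<close>

lemma noise_square_le_powr:
  fixes g :: "(nat \<Rightarrow> real) \<Rightarrow> real"
  assumes "finite I" and g: "\<And>x. x \<in> signs I \<Longrightarrow> 0 \<le> g x"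
    and r: "0 < r" "r \<le> 1" "avg I g \<le> r * sqrt (avg I (\<lambda>x. (g x)\<^sup>2))"
    and \<rho>: "0 \<le> \<rho>" "\<rho> < 1"
  shows "avg I (\<lambda>x. (noise I \<rho> g x)\<^sup>2) \<le> avg I (\<lambda>x. (g x)\<^sup>2) * r powr ((1 - \<rho>\<^sup>2) / 4)"
proof -
  have \<rho>2: "\<rho>\<^sup>2 \<le> 1" using \<rho> by (simp add: power_le_one)
  define P where "P = (\<lambda>k::nat. 3 * (\<rho> ^ 2 ^ k)\<^sup>2 \<le> 1)"
  have "\<exists>k. P k"
  proof -
    obtain n where n: "\<rho> ^ n < 1 / 3" using real_arch_pow_inv[of "1/3" \<rho>] \<rho> by auto
    have "\<rho> ^ 2 ^ n \<le> \<rho> ^ n" using \<rho> by (intro power_decreasing) (auto intro: less_imp_le)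
    moreover have "(\<rho> ^ 2 ^ n)\<^sup>2 \<le> \<rho> ^ 2 ^ n"
      using \<rho> by (simp add: power2_eq_square mult_left_le power_le_one)
    ultimately show ?thesis using n unfolding P_def by (intro exI[of _ n]) linarith
  qed
  define k where "k = (LEAST k. P k)"
  have k: "P k" unfolding k_def by (rule LeastI_ex) fact
  have "(1 - \<rho>\<^sup>2) / 4 \<le> 1 / 2 ^ k"
  proof (cases k)
    case 0
    then show ?thesis using \<rho> by simp (smt (verit) zero_le_power2)
  next
    case (Suc j)
    then have "\<not> P j" unfolding k_def by (metis lessI not_less_Least)
    then have big: "1 / 3 < (\<rho>\<^sup>2) ^ (2 ^ j)"
      unfolding P_def by (simp add: power_mult[symmetric] mult.commute)
    define m :: real where "m = 2 ^ j"
    \<comment> \<open>Bernoulli bounds \<open>m (1 - \<rho>\<^sup>2)\<close> through \<open>\<rho>\<^bsup>-2m\<^esup>\<close>, because \<open>2 - \<rho>\<^sup>2 \<le> \<rho>\<^bsup>-2\<^esup>\<close>.\<close>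
    have "1 + m * (1 - \<rho>\<^sup>2) \<le> (1 + (1 - \<rho>\<^sup>2)) ^ (2 ^ j)"
      using Bernoulli_inequality[of "1 - \<rho>\<^sup>2" "2 ^ j"] \<rho>2 by (simp add: m_def)
    then have "(1 / 3) * (1 + m * (1 - \<rho>\<^sup>2)) \<le> (\<rho>\<^sup>2) ^ (2 ^ j) * (1 + (1 - \<rho>\<^sup>2)) ^ (2 ^ j)"
      using big \<rho>2 by (intro mult_mono) (auto simp: m_def)
    also have "\<dots> = (\<rho>\<^sup>2 * (2 - \<rho>\<^sup>2)) ^ (2 ^ j)" by (simp add: power_mult_distrib)
    also have "\<dots> \<le> 1"
    proof (rule power_le_one)
      have "0 \<le> (1 - \<rho>\<^sup>2)\<^sup>2" by simp
      then show "\<rho>\<^sup>2 * (2 - \<rho>\<^sup>2) \<le> 1" by (simp add: power2_eq_square algebra_simps)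
    qed (use \<rho>2 in auto)
    finally have "m * (1 - \<rho>\<^sup>2) \<le> 2" by simp
    then show ?thesis unfolding Suc m_def by (simp add: field_simps)
  qed
  then have "r powr (1 / 2 ^ k) \<le> r powr ((1 - \<rho>\<^sup>2) / 4)"
    using r by (intro powr_mono') auto
  moreover have "avg I (\<lambda>x. (noise I \<rho> g x)\<^sup>2) \<le> avg I (\<lambda>x. (g x)\<^sup>2) * r powr (1 / 2 ^ k)"
    using k unfolding P_def by (intro noise_square_le_dyadic assms) auto
  ultimately show ?thesis
    by (meson avg_nonneg mult_left_mono order_trans zero_le_power2)
qed

section \<open>The derivative of the noise operator\<close>

definition disc_deriv :: "nat \<Rightarrow> ((nat \<Rightarrow> real) \<Rightarrow> 'a::real_normed_vector) \<Rightarrow> (nat \<Rightarrow> real) \<Rightarrow> 'a" where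
  "disc_deriv i f x = (1 / 2) *\<^sub>R (f x - f (flip i x))"

lemma kernel_flip:
  "kernel I \<rho> (flip i x) y = kernel I \<rho> x (flip i y)"
  unfolding kernel_def by (rule prod.cong) (auto simp: flip_def)

text \<open>
  As a function of \<open>y\<^sub>i\<close>, the weight \<open>kernel I \<rho> x y (x\<^sub>i y\<^sub>i - \<rho>)\<close> is proportional
  to \<open>(1 + \<rho> x\<^sub>i y\<^sub>i) (x\<^sub>i y\<^sub>i - \<rho>) = (1 - \<rho>\<^sup>2) x\<^sub>i y\<^sub>i\<close>, which is odd.
\<close>

lemma kernel_flip_balance:
  assumes "finite I" "i \<in> I" "x \<in> signs I" "y \<in> signs I"
  shows "kernel I \<rho> x (flip i y) * (x i * flip i y i - \<rho>) = - (kernel I \<rho> x y * (x i * y i - \<rho>))"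
proof -
  have K: "kernel I \<rho> x z = (1 + \<rho> * x i * z i) / 2 * kernel (I - {i}) \<rho> x z" for z
    using assms by (simp add: kernel_def prod.remove)
  have F: "kernel (I - {i}) \<rho> x (flip i y) = kernel (I - {i}) \<rho> x y"
    unfolding kernel_def by (rule prod.cong) (auto simp: flip_def)
  have odd: "(1 + \<rho> * x i * flip i y i) / 2 * (x i * flip i y i - \<rho>)
      = - ((1 + \<rho> * x i * y i) / 2 * (x i * y i - \<rho>))"
    using signs_cases[OF assms(3,2)] signs_cases[OF assms(4,2)]
    by (auto simp: flip_def field_simps)
  have "kernel I \<rho> x (flip i y) * (x i * flip i y i - \<rho>)
      = ((1 + \<rho> * x i * flip i y i) / 2 * (x i * flip i y i - \<rho>)) * kernel (I - {i}) \<rho> x y"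
    unfolding K[of "flip i y"] F by (simp only: mult_ac)
  also have "\<dots> = - (kernel I \<rho> x y * (x i * y i - \<rho>))"
    unfolding odd K[of y] mult_minus_left by (simp only: mult_ac)
  finally show ?thesis .
qed

lemma noise_disc_deriv:
  assumes "i \<in> I"
  shows "disc_deriv i (noise I \<rho> f) x = noise I \<rho> (disc_deriv i f) x"
proof -
  have "noise I \<rho> f (flip i x) = (\<Sum>y\<in>signs I. kernel I \<rho> x (flip i y) *\<^sub>R f (flip i (flip i y)))"
    by (simp add: noise_def kernel_flip)
  also have "\<dots> = (\<Sum>y\<in>signs I. kernel I \<rho> x y *\<^sub>R f (flip i y))"
    by (rule sum_flip[OF assms])
  finally show ?thesis
    by (simp add: disc_deriv_def noise_def scaleR_diff_right sum_subtractf scaleR_sum_right scaleR_left_commute)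
qed

text \<open>
  The weight is odd in \<open>y\<^sub>i\<close>, so only the odd part of \<open>f\<close> in that coordinate contributes, and this
  part is \<^term>\<open>disc_deriv i f\<close>.
\<close>

lemma sum_kernel_disc_deriv:
  fixes f :: "(nat \<Rightarrow> real) \<Rightarrow> 'a::real_normed_vector"
  assumes "finite I" "i \<in> I" "x \<in> signs I"
  shows "(\<Sum>y\<in>signs I. (kernel I \<rho> x y * (x i * y i - \<rho>)) *\<^sub>R f y)
    = (\<Sum>y\<in>signs I. (kernel I \<rho> x y * (x i * y i - \<rho>)) *\<^sub>R disc_deriv i f y)"
proof -
  let ?k = "\<lambda>y. kernel I \<rho> x y * (x i * y i - \<rho>)"
  have "(\<Sum>y\<in>signs I. ?k y *\<^sub>R f (flip i y)) = (\<Sum>y\<in>signs I. ?k (flip i y) *\<^sub>R f (flip i (flip i y)))"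
    by (rule sum_flip[OF assms(2), symmetric])
  also have "\<dots> = - (\<Sum>y\<in>signs I. ?k y *\<^sub>R f y)"
    by (simp add: kernel_flip_balance assms flip: sum_negf)
  finally have *: "(\<Sum>y\<in>signs I. ?k y *\<^sub>R f (flip i y)) = - (\<Sum>y\<in>signs I. ?k y *\<^sub>R f y)" .
  have "(\<Sum>y\<in>signs I. ?k y *\<^sub>R disc_deriv i f y)
      = (1 / 2) *\<^sub>R ((\<Sum>y\<in>signs I. ?k y *\<^sub>R f y) - (\<Sum>y\<in>signs I. ?k y *\<^sub>R f (flip i y)))"
    by (simp add: disc_deriv_def scaleR_diff_right sum_subtractf scaleR_sum_right mult_ac)
  also have "\<dots> = (\<Sum>y\<in>signs I. ?k y *\<^sub>R f y)"
    unfolding * by (simp flip: scaleR_2)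
  finally show ?thesis by simp
qed

lemma sum_kernel_coordinate:
  assumes "finite I" "i \<in> I" "x \<in> signs I"
  shows "(\<Sum>y\<in>signs I. kernel I \<rho> x y * y i) = \<rho> * x i"
proof -
  \<comment> \<open>The constant function has no odd part.\<close>
  have "(\<Sum>y\<in>signs I. (kernel I \<rho> x y * (x i * y i - \<rho>)) *\<^sub>R (1::real)) = 0"
    by (subst sum_kernel_disc_deriv[OF assms]) (simp add: disc_deriv_def)
  also have "(\<Sum>y\<in>signs I. (kernel I \<rho> x y * (x i * y i - \<rho>)) *\<^sub>R (1::real))
      = x i * (\<Sum>y\<in>signs I. kernel I \<rho> x y * y i) - \<rho> * (\<Sum>y\<in>signs I. kernel I \<rho> x y)"
    by (simp add: right_diff_distrib sum_subtractf sum_distrib_left mult_ac)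
  finally have "x i * (\<Sum>y\<in>signs I. kernel I \<rho> x y * y i) = \<rho>"
    by (simp add: sum_kernel[OF assms(1)])
  then have "\<rho> * x i = (x i * x i) * (\<Sum>y\<in>signs I. kernel I \<rho> x y * y i)"
    by (simp add: mult_ac)
  then show ?thesis
    using signs_square[OF assms(3,2)] by simp
qed

text \<open>
  The derivative of the kernel in \<open>\<rho>\<close>, for \<open>\<bar>\<rho>\<bar> < 1\<close>.
\<close>

definition dkernel :: "nat set \<Rightarrow> real \<Rightarrow> (nat \<Rightarrow> real) \<Rightarrow> (nat \<Rightarrow> real) \<Rightarrow> real" where
  "dkernel I \<rho> x y = (\<Sum>i\<in>I. kernel I \<rho> x y * (x i * y i - \<rho>)) / (1 - \<rho>\<^sup>2)"

text \<open>
  Logarithmic differentiation of the product; the factor of the coordinate \<open>i\<close> contributes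
  \<open>\<xi> / (1 + \<rho> \<xi>) = (\<xi> - \<rho>) / (1 - \<rho>\<^sup>2)\<close> with \<open>\<xi> = x\<^sub>i y\<^sub>i = \<plusminus>1\<close>.
\<close>

lemma kernel_has_derivative:
  assumes "finite I" "\<bar>\<rho>\<bar> < 1" "x \<in> signs I" "y \<in> signs I"
  shows "((\<lambda>\<rho>. kernel I \<rho> x y) has_real_derivative dkernel I \<rho> x y) (at \<rho>)"
proof -
  have \<rho>: "\<rho>\<^sup>2 < 1" using assms(2) by (simp add: abs_square_less_1)
  have xy: "x i * y i = 1 \<or> x i * y i = -1" if "i \<in> I" for i
    using signs_cases[OF assms(3) that] signs_cases[OF assms(4) that] by auto
  have nz: "(1 + \<rho> * x i * y i) / 2 \<noteq> 0" if "i \<in> I" for i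
    using xy[OF that] assms(2) by (auto simp: mult.assoc)
  have "((\<lambda>\<rho>. \<Prod>i\<in>I. (1 + \<rho> * x i * y i) / 2) has_real_derivative
      (\<Prod>i\<in>I. (1 + \<rho> * x i * y i) / 2) * (\<Sum>i\<in>I. (x i * y i / 2) / ((1 + \<rho> * x i * y i) / 2))) (at \<rho>)"
    by (rule has_field_derivative_prod') (use nz in \<open>auto intro!: derivative_eq_intros\<close>)
  also have "(\<Sum>i\<in>I. (x i * y i / 2) / ((1 + \<rho> * x i * y i) / 2)) = (\<Sum>i\<in>I. (x i * y i - \<rho>) / (1 - \<rho>\<^sup>2))"
  proof (rule sum.cong)
    fix i assume that: "i \<in> I"
    show "(x i * y i / 2) / ((1 + \<rho> * x i * y i) / 2) = (x i * y i - \<rho>) / (1 - \<rho>\<^sup>2)"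
    proof -
      define t where "t = x i * y i"
      have t: "t = 1 \<or> t = -1" using xy[OF that] by (simp add: t_def)
      have "(t / 2) / ((1 + \<rho> * t) / 2) = (t - \<rho>) / (1 - \<rho>\<^sup>2)"
      proof -
        have "(1 + \<rho> * t) * (t - \<rho>) = t * (1 - \<rho>\<^sup>2)"
          using t by (auto simp: power2_eq_square algebra_simps)
        moreover have "1 + \<rho> * t \<noteq> 0" using t assms(2) by auto
        ultimately show ?thesis using \<rho> by (simp add: field_simps)
      qed
      then show ?thesis by (simp add: t_def mult.assoc)
    qed
  qed simp
  finally show ?thesis
    by (simp add: dkernel_def kernel_def sum_divide_distrib sum_distrib_left)
qed

text \<open>
  Writing the derivative at \<open>\<rho>\<^sup>2\<close> as a composition with noise of parameter \<open>\<rho>\<close> is what lets the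
  smoothing estimates act on the discrete derivatives. The formula follows by differentiating the
  semigroup identity in its first parameter only and comparing with the chain rule.
\<close>

lemma kernel_square_has_derivative:
  assumes "finite I" "0 \<le> \<rho>" "\<rho> < 1" "x \<in> signs I" "y \<in> signs I"
  shows "((\<lambda>\<rho>. kernel I (\<rho>\<^sup>2) x y) has_real_derivative
    2 * (\<Sum>z\<in>signs I. dkernel I \<rho> x z * kernel I \<rho> z y)) (at \<rho>)"
proof -
  have sq: "\<rho>\<^sup>2 < 1" using assms by (simp add: abs_square_less_1)
  have d1: "((\<lambda>\<sigma>. kernel I (\<sigma> * \<rho>) x y) has_real_derivative dkernel I (\<rho> * \<rho>) x y * \<rho>) (at \<rho>)"
    by (rule DERIV_chain2[of "\<lambda>t. kernel I t x y" _ "\<lambda>\<sigma>. \<sigma> * \<rho>"])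
       (use assms sq in \<open>auto intro!: kernel_has_derivative derivative_eq_intros simp: power2_eq_square abs_mult\<close>)
  have "((\<lambda>\<sigma>. \<Sum>z\<in>signs I. kernel I \<sigma> x z * kernel I \<rho> z y) has_real_derivative
      (\<Sum>z\<in>signs I. dkernel I \<rho> x z * kernel I \<rho> z y)) (at \<rho>)"
    by (rule DERIV_sum) (use assms in \<open>auto intro!: derivative_eq_intros kernel_has_derivative\<close>)
  then have "((\<lambda>\<sigma>. kernel I (\<sigma> * \<rho>) x y) has_real_derivative
      (\<Sum>z\<in>signs I. dkernel I \<rho> x z * kernel I \<rho> z y)) (at \<rho>)"
    by (simp add: kernel_compose assms)
  with d1 have eq: "dkernel I (\<rho> * \<rho>) x y * \<rho> = (\<Sum>z\<in>signs I. dkernel I \<rho> x z * kernel I \<rho> z y)"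
    by (rule DERIV_unique)
  have "((\<lambda>\<rho>. kernel I (\<rho>\<^sup>2) x y) has_real_derivative dkernel I (\<rho>\<^sup>2) x y * (2 * \<rho>)) (at \<rho>)"
    by (rule DERIV_chain2[of "\<lambda>t. kernel I t x y" _ "\<lambda>\<sigma>. \<sigma>\<^sup>2"])
       (use assms sq in \<open>auto intro!: kernel_has_derivative derivative_eq_intros\<close>)
  moreover have "dkernel I (\<rho>\<^sup>2) x y * (2 * \<rho>) = 2 * (dkernel I (\<rho> * \<rho>) x y * \<rho>)"
    by (simp add: power2_eq_square)
  ultimately show ?thesis by (simp only: eq)
qed

text \<open>
  The derivative of \<open>\<rho> \<mapsto> P\<^bsub>\<rho>\<^sup>2\<^esub> f x\<close>, for \<open>0 \<le> \<rho> < 1\<close>.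
\<close>

definition dnoise_square ::
  "nat set \<Rightarrow> real \<Rightarrow> ((nat \<Rightarrow> real) \<Rightarrow> 'a::real_normed_vector) \<Rightarrow> (nat \<Rightarrow> real) \<Rightarrow> 'a" where
  "dnoise_square I \<rho> f x = (2 / (1 - \<rho>\<^sup>2)) *\<^sub>R
     (\<Sum>y\<in>signs I. kernel I \<rho> x y *\<^sub>R (\<Sum>i\<in>I. (x i * y i - \<rho>) *\<^sub>R noise I \<rho> (disc_deriv i f) y))"

lemma noise_square_has_derivative:
  fixes f :: "(nat \<Rightarrow> real) \<Rightarrow> 'a::real_normed_vector"
  assumes "finite I" "0 \<le> \<rho>" "\<rho> < 1" "x \<in> signs I"
  shows "((\<lambda>\<rho>. noise I (\<rho>\<^sup>2) f x) has_vector_derivative dnoise_square I \<rho> f x) (at \<rho>)"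
proof -
  define h where "h = noise I \<rho> f"
  have "((\<lambda>\<rho>. noise I (\<rho>\<^sup>2) f x) has_vector_derivative
      (\<Sum>y\<in>signs I. (2 * (\<Sum>z\<in>signs I. dkernel I \<rho> x z * kernel I \<rho> z y)) *\<^sub>R f y)) (at \<rho>)"
    unfolding noise_def
    by (rule has_vector_derivative_sum)
       (use assms in \<open>auto intro!: derivative_eq_intros kernel_square_has_derivative\<close>)
  also have "(\<Sum>y\<in>signs I. (2 * (\<Sum>z\<in>signs I. dkernel I \<rho> x z * kernel I \<rho> z y)) *\<^sub>R f y)
      = 2 *\<^sub>R (\<Sum>z\<in>signs I. dkernel I \<rho> x z *\<^sub>R h z)"
    unfolding h_def noise_def scaleR_sum_right sum_distrib_left scaleR_sum_left
    by (subst sum.swap) (simp add: mult_ac)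
  also have "(\<Sum>z\<in>signs I. dkernel I \<rho> x z *\<^sub>R h z)
      = (1 / (1 - \<rho>\<^sup>2)) *\<^sub>R (\<Sum>i\<in>I. \<Sum>z\<in>signs I. (kernel I \<rho> x z * (x i * z i - \<rho>)) *\<^sub>R h z)"
    by (subst sum.swap) (simp add: dkernel_def scaleR_sum_right scaleR_sum_left sum_divide_distrib)
  also have "(\<Sum>i\<in>I. \<Sum>z\<in>signs I. (kernel I \<rho> x z * (x i * z i - \<rho>)) *\<^sub>R h z)
      = (\<Sum>i\<in>I. \<Sum>z\<in>signs I. (kernel I \<rho> x z * (x i * z i - \<rho>)) *\<^sub>R noise I \<rho> (disc_deriv i f) z)"
  proof (rule sum.cong)
    fix i assume "i \<in> I"
    have "disc_deriv i h z = noise I \<rho> (disc_deriv i f) z" for z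
      unfolding h_def by (rule noise_disc_deriv[OF \<open>i \<in> I\<close>])
    then show "(\<Sum>z\<in>signs I. (kernel I \<rho> x z * (x i * z i - \<rho>)) *\<^sub>R h z)
        = (\<Sum>z\<in>signs I. (kernel I \<rho> x z * (x i * z i - \<rho>)) *\<^sub>R noise I \<rho> (disc_deriv i f) z)"
      by (subst sum_kernel_disc_deriv[OF assms(1) \<open>i \<in> I\<close> assms(4)]) simp
  qed simp
  also have "2 *\<^sub>R (1 / (1 - \<rho>\<^sup>2)) *\<^sub>R \<dots> = dnoise_square I \<rho> f x"
    by (subst sum.swap) (simp add: dnoise_square_def scaleR_sum_right)
  finally show ?thesis .
qed

section \<open>Type 2 and biased signs\<close>

definition type2_on :: "'a::real_normed_vector itself \<Rightarrow> nat set \<Rightarrow> real \<Rightarrow> bool" where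
  "type2_on X I T \<longleftrightarrow> (\<forall>v :: nat \<Rightarrow> 'a.
     avg I (\<lambda>\<epsilon>. (norm (\<Sum>i\<in>I. \<epsilon> i *\<^sub>R v i))\<^sup>2) \<le> T\<^sup>2 * (\<Sum>i\<in>I. (norm (v i))\<^sup>2))"

text \<open>
  For independent \<open>x\<close> and \<open>x'\<close> with the same law, exchanging \<open>x\<^sub>i\<close> and \<open>x'\<^sub>i\<close> on any set of
  coordinates preserves the joint law, so the differences may be multiplied by arbitrary signs
  \<open>\<epsilon>\<^sub>i\<close>. Averaging over these signs brings in type 2, and
  \<open>E (x\<^sub>i - x'\<^sub>i)\<^sup>2 = 2 (1 - \<rho>\<^sup>2)\<close>.
\<close>

lemma type2_on_symmetrized_bias:
  fixes v :: "nat \<Rightarrow> 'a::real_normed_vector"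
  assumes "finite I" and type2: "type2_on TYPE('a) I T" and \<rho>: "0 \<le> \<rho>" "\<rho> \<le> 1" and y: "y \<in> signs I"
  shows "(\<Sum>x\<in>signs I. \<Sum>x'\<in>signs I. kernel I \<rho> y x * kernel I \<rho> y x' * (norm (\<Sum>i\<in>I. (x i - x' i) *\<^sub>R v i))\<^sup>2)
    \<le> 2 * T\<^sup>2 * (1 - \<rho>\<^sup>2) * (\<Sum>i\<in>I. (norm (v i))\<^sup>2)"
proof -
  let ?S = "signs I \<times> signs I"
  define w where "w = (\<lambda>(x, x'). kernel I \<rho> y x * kernel I \<rho> y x')"
  define D where "D = (\<lambda>\<epsilon> (x, x'). (norm (\<Sum>i\<in>I. \<epsilon> i *\<^sub>R (x i - x' i) *\<^sub>R v i))\<^sup>2)"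
  have w0: "0 \<le> w p" if "p \<in> ?S" for p
    using that kernel_nonneg[OF \<rho> y] by (auto simp: w_def)
  have swap: "(\<Sum>p\<in>?S. w p * D \<epsilon> p) = (\<Sum>p\<in>?S. w p * D (\<lambda>_. 1) p)" if "\<epsilon> \<in> signs I" for \<epsilon>
  proof -
    \<comment> \<open>The exchange of \<open>x\<^sub>i\<close> and \<open>x'\<^sub>i\<close> where \<open>\<epsilon>\<^sub>i = -1\<close>; outside \<open>I\<close> the default value is kept.\<close>
    define s where "s = (\<lambda>(x :: nat \<Rightarrow> real, x' :: nat \<Rightarrow> real).
      (\<lambda>i. if i \<in> I \<and> \<epsilon> i = -1 then x' i else x i, \<lambda>i. if i \<in> I \<and> \<epsilon> i = -1 then x i else x' i))"
    have sS: "s p \<in> ?S" if "p \<in> ?S" for p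
      using that by (auto simp: s_def signs_def PiE_iff extensional_def; metis)
    have ss: "s (s p) = p" for p
      by (auto simp: s_def fun_eq_iff split: prod.splits)
    have ws: "w (s p) = w p" for p
      unfolding w_def s_def kernel_def
      by (auto simp flip: prod.distrib split: prod.splits intro!: prod.cong)
    have Ds: "D (\<lambda>_. 1) (s p) = D \<epsilon> p" for p
    proof -
      have "(\<Sum>i\<in>I. (fst (s p) i - snd (s p) i) *\<^sub>R v i) = (\<Sum>i\<in>I. \<epsilon> i *\<^sub>R (fst p i - snd p i) *\<^sub>R v i)"
        using signs_cases[OF that] by (intro sum.cong) (auto simp: s_def split: prod.splits)
      then show ?thesis by (simp add: D_def case_prod_unfold)
    qed
    show ?thesis
      by (rule sum.reindex_bij_witness[where i = s and j = s]) (auto simp only: ss sS ws Ds)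
  qed
  have var: "(\<Sum>p\<in>?S. w p * (fst p i - snd p i)\<^sup>2) = 2 * (1 - \<rho>\<^sup>2)" if "i \<in> I" for i
  proof -
    have "(\<Sum>p\<in>?S. w p * (fst p i - snd p i)\<^sup>2)
        = (\<Sum>x\<in>signs I. \<Sum>x'\<in>signs I. 2 * (kernel I \<rho> y x * kernel I \<rho> y x')
            - 2 * (kernel I \<rho> y x * x i * (kernel I \<rho> y x' * x' i)))"
      unfolding sum.cartesian_product w_def
    proof (rule sum.cong)
      fix p assume "p \<in> ?S"
      then have "fst p i * fst p i = 1" "snd p i * snd p i = 1"
        using signs_square[OF _ that] by auto
      then have eq: "(fst p i - snd p i)\<^sup>2 = 2 - 2 * (fst p i * snd p i)"
        by (simp add: power2_eq_square algebra_simps)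
      show "(case p of (x, x') \<Rightarrow> kernel I \<rho> y x * kernel I \<rho> y x') * (fst p i - snd p i)\<^sup>2
          = (case p of (x, x') \<Rightarrow> 2 * (kernel I \<rho> y x * kernel I \<rho> y x')
            - 2 * (kernel I \<rho> y x * x i * (kernel I \<rho> y x' * x' i)))"
        unfolding case_prod_unfold eq by (simp add: algebra_simps)
    qed simp
    also have "\<dots> = 2 * ((\<Sum>x\<in>signs I. kernel I \<rho> y x) * (\<Sum>x\<in>signs I. kernel I \<rho> y x))
        - 2 * ((\<Sum>x\<in>signs I. kernel I \<rho> y x * x i) * (\<Sum>x\<in>signs I. kernel I \<rho> y x * x i))"
      unfolding sum_product by (simp only: sum_subtractf sum_distrib_left)
    also have "\<dots> = 2 - 2 * (\<rho> * \<rho> * (y i * y i))"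
      unfolding sum_kernel[OF assms(1)] sum_kernel_coordinate[OF assms(1) that y] by (simp add: mult_ac)
    also have "\<dots> = 2 * (1 - \<rho>\<^sup>2)"
      using signs_square[OF y that] by (simp add: power2_eq_square)
    finally show ?thesis .
  qed
  have "(\<Sum>p\<in>?S. w p * D (\<lambda>_. 1) p) = avg I (\<lambda>\<epsilon>. \<Sum>p\<in>?S. w p * D (\<lambda>_. 1) p)"
    by (rule avg_const[OF assms(1), symmetric])
  also have "\<dots> = avg I (\<lambda>\<epsilon>. \<Sum>p\<in>?S. w p * D \<epsilon> p)"
    by (rule avg_cong) (rule swap[symmetric])
  also have "\<dots> = (\<Sum>p\<in>?S. w p * avg I (\<lambda>\<epsilon>. D \<epsilon> p))"
    by (simp add: avg_sum avg_cmult)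
  also have "\<dots> \<le> (\<Sum>p\<in>?S. w p * (T\<^sup>2 * (\<Sum>i\<in>I. (norm ((fst p i - snd p i) *\<^sub>R v i))\<^sup>2)))"
  proof (intro sum_mono mult_left_mono)
    fix p
    show "avg I (\<lambda>\<epsilon>. D \<epsilon> p) \<le> T\<^sup>2 * (\<Sum>i\<in>I. (norm ((fst p i - snd p i) *\<^sub>R v i))\<^sup>2)"
      using spec[OF type2[unfolded type2_on_def], of "\<lambda>i. (fst p i - snd p i) *\<^sub>R v i"]
      unfolding D_def case_prod_unfold .
  qed (use w0 in auto)
  also have "\<dots> = (\<Sum>p\<in>?S. \<Sum>i\<in>I. T\<^sup>2 * (norm (v i))\<^sup>2 * (w p * (fst p i - snd p i)\<^sup>2))"
    by (simp add: sum_distrib_left power_mult_distrib mult_ac)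
  also have "\<dots> = (\<Sum>i\<in>I. T\<^sup>2 * (norm (v i))\<^sup>2 * (\<Sum>p\<in>?S. w p * (fst p i - snd p i)\<^sup>2))"
    by (subst sum.swap) (simp add: sum_distrib_left)
  also have "\<dots> = (\<Sum>i\<in>I. 2 * T\<^sup>2 * (1 - \<rho>\<^sup>2) * (norm (v i))\<^sup>2)"
    by (rule sum.cong) (simp_all add: var algebra_simps)
  also have "\<dots> = 2 * T\<^sup>2 * (1 - \<rho>\<^sup>2) * (\<Sum>i\<in>I. (norm (v i))\<^sup>2)"
    by (rule sum_distrib_left[symmetric])
  finally show ?thesis
    by (simp add: sum.cartesian_product w_def D_def case_prod_unfold)
qed

text \<open>
  Under the law \<open>kernel I \<rho> y\<close> the mean of \<open>x\<^sub>i\<close> is \<open>\<rho> y\<^sub>i\<close>, so up to the signs \<open>y\<^sub>i\<close> the sum is centred;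
  by Jensen, subtracting an independent copy can only increase its second moment.
\<close>

lemma type2_on_centred_bias:
  fixes v :: "nat \<Rightarrow> 'a::real_normed_vector"
  assumes "finite I" "type2_on TYPE('a) I T" "0 \<le> \<rho>" "\<rho> \<le> 1" and y: "y \<in> signs I"
  shows "(\<Sum>x\<in>signs I. kernel I \<rho> x y * (norm (\<Sum>i\<in>I. (x i * y i - \<rho>) *\<^sub>R v i))\<^sup>2)
    \<le> 2 * T\<^sup>2 * (1 - \<rho>\<^sup>2) * (\<Sum>i\<in>I. (norm (v i))\<^sup>2)"
proof -
  define u where "u = (\<lambda>i. y i *\<^sub>R v i)"
  have nu: "norm (u i) = norm (v i)" if "i \<in> I" for i
    using signs_cases[OF y that] by (auto simp: u_def)
  have center: "(\<Sum>i\<in>I. (x i * y i - \<rho>) *\<^sub>R v i)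
      = (\<Sum>x'\<in>signs I. kernel I \<rho> y x' *\<^sub>R (\<Sum>i\<in>I. (x i - x' i) *\<^sub>R u i))" for x
  proof -
    have "(\<Sum>x'\<in>signs I. kernel I \<rho> y x' *\<^sub>R (\<Sum>i\<in>I. (x i - x' i) *\<^sub>R u i))
        = (\<Sum>i\<in>I. (\<Sum>x'\<in>signs I. kernel I \<rho> y x' * (x i - x' i)) *\<^sub>R u i)"
      unfolding scaleR_sum_right scaleR_sum_left by (subst sum.swap) simp
    also have "\<dots> = (\<Sum>i\<in>I. (x i - \<rho> * y i) *\<^sub>R u i)"
      using assms
      by (intro sum.cong refl)
         (simp add: right_diff_distrib sum_subtractf sum_kernel_coordinate sum_kernel flip: sum_distrib_right)
    also have "\<dots> = (\<Sum>i\<in>I. (x i * y i - \<rho>) *\<^sub>R v i)"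
      by (intro sum.cong refl)
         (use signs_square[OF y] in \<open>simp add: u_def left_diff_distrib mult.assoc\<close>)
    finally show ?thesis by simp
  qed
  have "(\<Sum>x\<in>signs I. kernel I \<rho> x y * (norm (\<Sum>i\<in>I. (x i * y i - \<rho>) *\<^sub>R v i))\<^sup>2)
      \<le> (\<Sum>x\<in>signs I. kernel I \<rho> y x * (\<Sum>x'\<in>signs I. kernel I \<rho> y x' * (norm (\<Sum>i\<in>I. (x i - x' i) *\<^sub>R u i))\<^sup>2))"
    unfolding center kernel_commute[of I \<rho> _ y]
    by (intro sum_mono mult_left_mono norm_convex_combination_square_le)
       (use assms in \<open>auto simp: kernel_nonneg sum_kernel\<close>)
  also have "\<dots> \<le> 2 * T\<^sup>2 * (1 - \<rho>\<^sup>2) * (\<Sum>i\<in>I. (norm (u i))\<^sup>2)"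
    using type2_on_symmetrized_bias[OF assms, of u] by (simp add: sum_distrib_left mult.assoc)
  also have "(\<Sum>i\<in>I. (norm (u i))\<^sup>2) = (\<Sum>i\<in>I. (norm (v i))\<^sup>2)"
    by (simp add: nu)
  finally show ?thesis .
qed

text \<open>
  After Jensen's inequality in \<open>y\<close> the order of summation is exchanged: for fixed \<open>y\<close> the vectors
  \<open>P\<^sub>\<rho> D\<^sub>i f y\<close> are constants, and the randomness of \<open>x\<close> sits in the biased signs alone.
\<close>

lemma avg_dnoise_square_le:
  fixes f :: "(nat \<Rightarrow> real) \<Rightarrow> 'a::real_normed_vector"
  assumes "finite I" "type2_on TYPE('a) I T" "0 \<le> \<rho>" "\<rho> < 1"
  shows "avg I (\<lambda>x. (norm (dnoise_square I \<rho> f x))\<^sup>2)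
    \<le> 8 * T\<^sup>2 / (1 - \<rho>\<^sup>2) * (\<Sum>i\<in>I. avg I (\<lambda>y. (norm (noise I \<rho> (disc_deriv i f) y))\<^sup>2))"
proof -
  have \<rho>: "\<rho>\<^sup>2 < 1" using assms by (simp add: abs_square_less_1)
  define V where "V = (\<lambda>x y. \<Sum>i\<in>I. (x i * y i - \<rho>) *\<^sub>R noise I \<rho> (disc_deriv i f) y)"
  have "(\<Sum>x\<in>signs I. (norm (dnoise_square I \<rho> f x))\<^sup>2)
      = 4 / (1 - \<rho>\<^sup>2)\<^sup>2 * (\<Sum>x\<in>signs I. (norm (\<Sum>y\<in>signs I. kernel I \<rho> x y *\<^sub>R V x y))\<^sup>2)"
    by (simp add: dnoise_square_def V_def power_mult_distrib power_divide sum_distrib_left)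
  also have "\<dots> \<le> 4 / (1 - \<rho>\<^sup>2)\<^sup>2 * (\<Sum>x\<in>signs I. \<Sum>y\<in>signs I. kernel I \<rho> x y * (norm (V x y))\<^sup>2)"
    by (intro mult_left_mono sum_mono norm_convex_combination_square_le)
       (use assms in \<open>auto simp: kernel_nonneg sum_kernel\<close>)
  also have "(\<Sum>x\<in>signs I. \<Sum>y\<in>signs I. kernel I \<rho> x y * (norm (V x y))\<^sup>2)
      = (\<Sum>y\<in>signs I. \<Sum>x\<in>signs I. kernel I \<rho> x y * (norm (V x y))\<^sup>2)"
    by (rule sum.swap)
  also have "4 / (1 - \<rho>\<^sup>2)\<^sup>2 * \<dots> \<le> 4 / (1 - \<rho>\<^sup>2)\<^sup>2 * (\<Sum>y\<in>signs I.
      2 * T\<^sup>2 * (1 - \<rho>\<^sup>2) * (\<Sum>i\<in>I. (norm (noise I \<rho> (disc_deriv i f) y))\<^sup>2))"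
    unfolding V_def by (intro mult_left_mono sum_mono type2_on_centred_bias) (use assms in auto)
  also have "\<dots> = (4 / (1 - \<rho>\<^sup>2)\<^sup>2 * (2 * T\<^sup>2 * (1 - \<rho>\<^sup>2)))
      * (\<Sum>i\<in>I. \<Sum>y\<in>signs I. (norm (noise I \<rho> (disc_deriv i f) y))\<^sup>2)"
    by (subst sum.swap) (simp only: mult.assoc flip: sum_distrib_left)
  also have "4 / (1 - \<rho>\<^sup>2)\<^sup>2 * (2 * T\<^sup>2 * (1 - \<rho>\<^sup>2)) = 8 * T\<^sup>2 / (1 - \<rho>\<^sup>2)"
    using \<rho> by (simp add: power2_eq_square[of "1 - \<rho>\<^sup>2"])
  finally have "(\<Sum>x\<in>signs I. (norm (dnoise_square I \<rho> f x))\<^sup>2) / 2 ^ card I \<le> 8 * T\<^sup>2 / (1 - \<rho>\<^sup>2)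
      * (\<Sum>i\<in>I. \<Sum>y\<in>signs I. (norm (noise I \<rho> (disc_deriv i f) y))\<^sup>2) / 2 ^ card I"
    by (rule divide_right_mono) simp
  then show ?thesis
    by (simp only: avg_def times_divide_eq_right flip: sum_divide_distrib)
qed

section \<open>Integration along the noise path\<close>

text \<open>
  Minkowski's integral inequality in the form of a mean value theorem. The target space need not be
  complete, so only norms are integrated: the pointwise mean value inequality bounds each increment
  \<open>w\<^sub>\<omega>\<close> by the integral of \<open>\<parallel>F'\<^sub>\<omega>\<parallel>\<close>, and pairing these integrals with the weights \<open>w\<^sub>\<omega>\<close>
  recovers the \<open>L\<^sup>2\<close>-norm of the increments.
\<close>

lemma L2_set_mean_value:
  fixes F F' :: "'b \<Rightarrow> real \<Rightarrow> 'a::real_normed_vector"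
  assumes "a \<le> b" and "finite A"
    and F: "\<And>\<omega> t. \<omega> \<in> A \<Longrightarrow> t \<in> {a..b} \<Longrightarrow> (F \<omega> has_vector_derivative F' \<omega> t) (at t)"
    and cont: "\<And>\<omega>. \<omega> \<in> A \<Longrightarrow> continuous_on {a..b} (F' \<omega>)"
    and \<psi>: "\<And>t. t \<in> {a..b} \<Longrightarrow> (\<psi> has_real_derivative \<psi>' t) (at t)"
    and bound: "\<And>t. t \<in> {a..b} \<Longrightarrow> L2_set (\<lambda>\<omega>. norm (F' \<omega> t)) A \<le> \<psi>' t"
  shows "L2_set (\<lambda>\<omega>. norm (F \<omega> b - F \<omega> a)) A \<le> \<psi> b - \<psi> a"
proof (cases "a = b")
  case True
  then show ?thesis by (simp add: L2_set_def)
next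
  case False
  with \<open>a \<le> b\<close> have "a < b" by simp
  define w where "w = (\<lambda>\<omega>. norm (F \<omega> b - F \<omega> a))"
  define W where "W = L2_set w A"
  define \<phi> where "\<phi> = (\<lambda>\<omega> t. integral {a..t} (\<lambda>s. norm (F' \<omega> s)))"
  have \<phi>: "(\<phi> \<omega> has_real_derivative norm (F' \<omega> t)) (at t within {a..b})"
    if "\<omega> \<in> A" "t \<in> {a..b}" for \<omega> t
    unfolding \<phi>_def
    by (rule integral_has_real_derivative) (use that cont in \<open>auto intro!: continuous_intros\<close>)
  have \<phi>_cont: "continuous_on {a..b} (\<phi> \<omega>)" if "\<omega> \<in> A" for \<omega>
    using \<phi>[OF that] by (meson DERIV_continuous continuous_on_eq_continuous_within)
  have \<phi>_at: "(\<phi> \<omega> has_real_derivative norm (F' \<omega> t)) (at t)"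
    if "\<omega> \<in> A" "a < t" "t < b" for \<omega> t
    using \<phi>[of \<omega> t] that by (simp add: at_within_Icc_at)
  have \<psi>_cont: "continuous_on {a..b} \<psi>"
    using \<psi> by (meson DERIV_isCont continuous_at_imp_continuous_on)
  have w_le: "w \<omega> \<le> \<phi> \<omega> b" if "\<omega> \<in> A" for \<omega>
  proof -
    have "norm (F \<omega> b - F \<omega> a) \<le> \<phi> \<omega> b - \<phi> \<omega> a"
    proof (rule differentiable_bound_general[OF \<open>a < b\<close>])
      show "continuous_on {a..b} (F \<omega>)"
        using F[OF that] by (meson continuous_at_imp_continuous_on has_vector_derivative_continuous)
    qed (use F \<phi>_at \<phi>_cont that in \<open>auto simp: has_real_derivative_iff_has_vector_derivative\<close>)
    then show ?thesis by (simp add: w_def \<phi>_def)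
  qed
  define \<Phi> where "\<Phi> = (\<lambda>t. \<Sum>\<omega>\<in>A. w \<omega> * \<phi> \<omega> t)"
  have "norm (\<Phi> b - \<Phi> a) \<le> W * \<psi> b - W * \<psi> a"
  proof (rule differentiable_bound_general[OF \<open>a < b\<close>])
    show "continuous_on {a..b} \<Phi>"
      unfolding \<Phi>_def by (intro continuous_intros \<phi>_cont)
    show "continuous_on {a..b} (\<lambda>t. W * \<psi> t)"
      by (intro continuous_intros \<psi>_cont)
    fix t assume t: "a < t" "t < b"
    show "(\<Phi> has_vector_derivative (\<Sum>\<omega>\<in>A. w \<omega> * norm (F' \<omega> t))) (at t)"
      unfolding \<Phi>_def has_real_derivative_iff_has_vector_derivative[symmetric]
      by (intro DERIV_sum DERIV_cmult \<phi>_at t)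
    show "((\<lambda>t. W * \<psi> t) has_vector_derivative W * \<psi>' t) (at t)"
      unfolding has_real_derivative_iff_has_vector_derivative[symmetric]
      using t by (intro DERIV_cmult \<psi>) auto
    have "(\<Sum>\<omega>\<in>A. \<bar>w \<omega>\<bar> * \<bar>norm (F' \<omega> t)\<bar>) \<le> W * L2_set (\<lambda>\<omega>. norm (F' \<omega> t)) A"
      unfolding W_def by (rule L2_set_mult_ineq)
    also have "\<dots> \<le> W * \<psi>' t"
      using t by (intro mult_left_mono bound) (auto simp: W_def)
    finally show "norm (\<Sum>\<omega>\<in>A. w \<omega> * norm (F' \<omega> t)) \<le> W * \<psi>' t"
      by (simp add: w_def sum_nonneg)
  qed
  moreover have "\<Phi> a = 0" by (simp add: \<Phi>_def \<phi>_def)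
  moreover have "W\<^sup>2 \<le> \<Phi> b"
  proof -
    have "W\<^sup>2 = (\<Sum>\<omega>\<in>A. w \<omega> * w \<omega>)"
      by (simp add: W_def L2_set_def sum_nonneg power2_eq_square)
    also have "\<dots> \<le> \<Phi> b"
      unfolding \<Phi>_def by (intro sum_mono mult_left_mono w_le) (simp_all add: w_def)
    finally show ?thesis .
  qed
  ultimately have "W * W \<le> W * (\<psi> b - \<psi> a)"
    by (simp add: power2_eq_square right_diff_distrib)
  moreover have "0 \<le> \<psi> b - \<psi> a"
  proof -
    have "\<psi> a \<le> \<psi> b"
    proof (rule DERIV_nonneg_imp_nondecreasing[OF \<open>a \<le> b\<close>])
      fix t assume "a \<le> t" "t \<le> b"
      then have t: "t \<in> {a..b}" by simp
      have "0 \<le> \<psi>' t" by (rule order_trans[OF L2_set_nonneg bound[OF t]])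
      with \<psi>[OF t] show "\<exists>y. (\<psi> has_real_derivative y) (at t) \<and> 0 \<le> y" by blast
    qed
    then show ?thesis by simp
  qed
  moreover have "0 \<le> W" by (simp add: W_def)
  ultimately have "W \<le> \<psi> b - \<psi> a"
    by (cases "W = 0") auto
  then show ?thesis by (simp add: W_def w_def)
qed

text \<open>
  The substitution \<open>\<rho> = sin \<theta>\<close> turns the integrand into \<open>1 / (1 + m cos\<^sup>2 \<theta>)\<close>, whose primitive is
  \<open>arctan (tan \<theta> / \<surd>(1 + m)) / \<surd>(1 + m)\<close>.
\<close>

lemma decay_primitive:
  fixes m \<rho> :: real
  assumes "0 \<le> m" "0 \<le> \<rho>" "\<rho> < 1"
  shows "((\<lambda>\<rho>. arctan (\<rho> / (sqrt (1 - \<rho>\<^sup>2) * sqrt (1 + m))) / sqrt (1 + m)) has_real_derivative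
    1 / (sqrt (1 - \<rho>\<^sup>2) * (1 + m * (1 - \<rho>\<^sup>2)))) (at \<rho>)"
proof -
  define q s where "q = sqrt (1 - \<rho>\<^sup>2)" and "s = sqrt (1 + m)"
  have \<rho>2: "\<rho>\<^sup>2 < 1" using assms by (simp add: abs_square_less_1)
  have q: "0 < q" "q\<^sup>2 = 1 - \<rho>\<^sup>2" and s: "0 < s" "s\<^sup>2 = 1 + m"
    using \<rho>2 assms by (simp_all add: q_def s_def)
  have sq: "((\<lambda>\<rho>. sqrt (1 - \<rho>\<^sup>2)) has_real_derivative - \<rho> / q) (at \<rho>)"
    using \<rho>2 by (auto intro!: derivative_eq_intros simp: q_def field_simps)
  have "((\<lambda>\<rho>. \<rho> / (sqrt (1 - \<rho>\<^sup>2) * s)) has_real_derivative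
      (1 * (q * s) - \<rho> * (- \<rho> / q * s)) / ((q * s) * (q * s))) (at \<rho>)"
    unfolding q_def
    by (rule DERIV_divide[OF DERIV_ident DERIV_cmult_right[OF sq[unfolded q_def]]])
       (use q s in \<open>auto simp: q_def\<close>)
  also have "(1 * (q * s) - \<rho> * (- \<rho> / q * s)) / ((q * s) * (q * s)) = (q\<^sup>2 + \<rho>\<^sup>2) / (q ^ 3 * s)"
    using q(1) s(1) by (simp add: field_simps power2_eq_square power3_eq_cube)
  also have "\<dots> = 1 / (q ^ 3 * s)" by (simp add: q(2))
  finally have "((\<lambda>\<rho>. arctan (\<rho> / (sqrt (1 - \<rho>\<^sup>2) * s)) / s) has_real_derivative
      inverse (1 + (\<rho> / (q * s))\<^sup>2) * (1 / (q ^ 3 * s)) / s) (at \<rho>)"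
    unfolding q_def by (rule DERIV_cdivide[OF DERIV_chain2[OF DERIV_arctan]])
  also have "inverse (1 + (\<rho> / (q * s))\<^sup>2) * (1 / (q ^ 3 * s)) / s = 1 / (q * (q\<^sup>2 * s\<^sup>2 + \<rho>\<^sup>2))"
  proof -
    have "1 + (\<rho> / (q * s))\<^sup>2 = (q\<^sup>2 * s\<^sup>2 + \<rho>\<^sup>2) / (q\<^sup>2 * s\<^sup>2)"
      using q(1) s(1) by (simp add: power_divide power_mult_distrib field_simps)
    then show ?thesis
      using q(1) s(1) by (simp add: power2_eq_square power3_eq_cube)
  qed
  also have "q\<^sup>2 * s\<^sup>2 + \<rho>\<^sup>2 = 1 + m * (1 - \<rho>\<^sup>2)"
    unfolding q(2) s(2) by (simp add: algebra_simps)
  finally show ?thesis by (simp add: q_def s_def)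
qed

text \<open>
  The smoothing estimate for vector-valued functions, through the pointwise bound
  \<open>\<parallel>P\<^sub>\<rho> h\<parallel> \<le> P\<^sub>\<rho> \<parallel>h\<parallel>\<close>. The exponential decay is relaxed to a rational one that has an elementary
  integral along the path.
\<close>

lemma avg_noise_square_decay:
  fixes f :: "(nat \<Rightarrow> real) \<Rightarrow> 'a::real_normed_vector"
  assumes "finite I" "0 \<le> L" "0 \<le> \<rho>" "\<rho> < 1"
    and L1: "avg I (\<lambda>x. norm (h x)) \<le> exp (- L) * sqrt (avg I (\<lambda>x. (norm (h x))\<^sup>2))"
  shows "avg I (\<lambda>x. (norm (noise I \<rho> h x))\<^sup>2)
    \<le> avg I (\<lambda>x. (norm (h x))\<^sup>2) * (1 / (1 + L / 8 * (1 - \<rho>\<^sup>2)))\<^sup>2"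
proof -
  define e where "e = L / 8 * (1 - \<rho>\<^sup>2)"
  have \<rho>: "\<rho>\<^sup>2 < 1" using assms by (simp add: abs_square_less_1)
  have e0: "0 \<le> e" using \<rho> assms by (simp add: e_def)
  have "avg I (\<lambda>x. (norm (noise I \<rho> h x))\<^sup>2) \<le> avg I (\<lambda>x. (noise I \<rho> (\<lambda>y. norm (h y)) x)\<^sup>2)"
    by (intro avg_mono power_mono norm_noise_le) (use assms in auto)
  also have "\<dots> \<le> avg I (\<lambda>x. (norm (h x))\<^sup>2) * exp (- L) powr ((1 - \<rho>\<^sup>2) / 4)"
    by (intro noise_square_le_powr) (use assms in auto)
  also have "exp (- L) powr ((1 - \<rho>\<^sup>2) / 4) = exp (2 * (- e))"
    unfolding powr_def ln_exp by (simp add: e_def)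
  also have "\<dots> = (1 / exp e)\<^sup>2"
    by (simp only: exp_double exp_minus inverse_eq_divide)
  also have "(1 / exp e)\<^sup>2 \<le> (1 / (1 + e))\<^sup>2"
    using e0 by (intro power_mono divide_left_mono) (auto simp: exp_ge_add_one_self)
  finally show ?thesis
    by (simp add: e_def mult_left_mono avg_nonneg)
qed

text \<open>
  The velocity estimate is integrated over \<open>[0, b]\<close> with \<open>b < 1\<close>, since both the formula for the
  derivative and the primitive degenerate at \<open>\<rho> = 1\<close>; continuity of the noise operator then gives
  the endpoint. For \<open>L = 0\<close> the hypothesis on the derivatives always holds, by Cauchy-Schwarz.
\<close>

theorem L1_L2_influence_inequality:
  fixes f :: "(nat \<Rightarrow> real) \<Rightarrow> 'a::real_normed_vector"
  assumes "finite I" "type2_on TYPE('a) I T" "0 \<le> T" "0 \<le> L"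
    and L1: "\<And>i. i \<in> I \<Longrightarrow> avg I (\<lambda>x. norm (disc_deriv i f x))
      \<le> exp (- L) * sqrt (avg I (\<lambda>x. (norm (disc_deriv i f x))\<^sup>2))"
  shows "avg I (\<lambda>x. (norm (f x - noise I 0 f x))\<^sup>2)
    \<le> 2 * pi\<^sup>2 * T\<^sup>2 / (1 + L / 8) * (\<Sum>i\<in>I. avg I (\<lambda>x. (norm (disc_deriv i f x))\<^sup>2))"
proof -
  define m where "m = L / 8"
  define A where "A = (\<Sum>i\<in>I. avg I (\<lambda>x. (norm (disc_deriv i f x))\<^sup>2))"
  define c where "c = sqrt (2 ^ card I) * (sqrt (8 * A) * T)"
  define \<psi> where "\<psi> = (\<lambda>\<rho>. arctan (\<rho> / (sqrt (1 - \<rho>\<^sup>2) * sqrt (1 + m))) / sqrt (1 + m))"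
  have m0: "0 \<le> m" and A0: "0 \<le> A" and c0: "0 \<le> c"
    using assms by (auto simp: m_def A_def c_def intro!: sum_nonneg avg_nonneg mult_nonneg_nonneg)
  have L2_avg: "L2_set g (signs I) = sqrt (2 ^ card I * avg I (\<lambda>x. (g x)\<^sup>2))" for g
    by (simp add: L2_set_def avg_def)
  have speed: "L2_set (\<lambda>x. norm (dnoise_square I \<rho> f x)) (signs I)
      \<le> c * (1 / (sqrt (1 - \<rho>\<^sup>2) * (1 + m * (1 - \<rho>\<^sup>2))))" if \<rho>: "0 \<le> \<rho>" "\<rho> < 1" for \<rho>
  proof -
    have \<rho>2: "\<rho>\<^sup>2 < 1" using \<rho> by (simp add: abs_square_less_1)
    have "avg I (\<lambda>x. (norm (dnoise_square I \<rho> f x))\<^sup>2)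
        \<le> 8 * T\<^sup>2 / (1 - \<rho>\<^sup>2) * (\<Sum>i\<in>I. avg I (\<lambda>y. (norm (noise I \<rho> (disc_deriv i f) y))\<^sup>2))"
      by (rule avg_dnoise_square_le[OF assms(1,2) \<rho>])
    also have "\<dots> \<le> 8 * T\<^sup>2 / (1 - \<rho>\<^sup>2) * (\<Sum>i\<in>I. avg I (\<lambda>x. (norm (disc_deriv i f x))\<^sup>2)
        * (1 / (1 + L / 8 * (1 - \<rho>\<^sup>2)))\<^sup>2)"
      by (intro mult_left_mono sum_mono avg_noise_square_decay L1) (use assms \<rho> \<rho>2 in auto)
    also have "\<dots> = (sqrt (8 * A) * T * (1 / (sqrt (1 - \<rho>\<^sup>2) * (1 + m * (1 - \<rho>\<^sup>2)))))\<^sup>2"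
      using \<rho>2 A0 by (simp add: A_def m_def power_mult_distrib power_divide flip: sum_distrib_right sum_divide_distrib)
    finally have "2 ^ card I * avg I (\<lambda>x. (norm (dnoise_square I \<rho> f x))\<^sup>2)
        \<le> 2 ^ card I * (sqrt (8 * A) * T * (1 / (sqrt (1 - \<rho>\<^sup>2) * (1 + m * (1 - \<rho>\<^sup>2)))))\<^sup>2"
      by (rule mult_left_mono) simp
    also have "\<dots> = (c * (1 / (sqrt (1 - \<rho>\<^sup>2) * (1 + m * (1 - \<rho>\<^sup>2)))))\<^sup>2"
      by (simp add: c_def power_mult_distrib power_divide)
    finally show ?thesis
      unfolding L2_avg using c0 m0 \<rho>2 by (intro real_le_lsqrt) (auto simp: avg_nonneg)
  qed
  have near: "L2_set (\<lambda>x. norm (noise I (b\<^sup>2) f x - noise I 0 f x)) (signs I)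
      \<le> c * (pi / 2 / sqrt (1 + m))" if b: "0 \<le> b" "b < 1" for b
  proof -
    have lt1: "t\<^sup>2 < 1" if "t \<in> {0..b}" for t
      using that b by (simp add: abs_square_less_1)
    have "L2_set (\<lambda>x. norm (noise I (b\<^sup>2) f x - noise I (0\<^sup>2) f x)) (signs I) \<le> c * \<psi> b - c * \<psi> 0"
    proof (rule L2_set_mean_value[where F' = "\<lambda>x t. dnoise_square I t f x"
          and \<psi>' = "\<lambda>t. c * (1 / (sqrt (1 - t\<^sup>2) * (1 + m * (1 - t\<^sup>2))))"])
      show "continuous_on {0..b} (\<lambda>t. dnoise_square I t f x)" for x
        unfolding dnoise_square_def noise_def kernel_def
        by (intro continuous_intros) (use lt1 in fastforce)+
      show "((\<lambda>t. c * \<psi> t) has_real_derivative c * (1 / (sqrt (1 - t\<^sup>2) * (1 + m * (1 - t\<^sup>2))))) (at t)"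
        if "t \<in> {0..b}" for t
        unfolding \<psi>_def by (intro DERIV_cmult decay_primitive) (use that b m0 in auto)
    qed (use assms b speed in \<open>auto intro!: noise_square_has_derivative\<close>)
    also have "c * \<psi> b - c * \<psi> 0 = c * \<psi> b" by (simp add: \<psi>_def)
    also have "\<dots> \<le> c * (pi / 2 / sqrt (1 + m))"
      unfolding \<psi>_def using c0 m0 arctan_ubound by (intro mult_left_mono divide_right_mono) (auto intro: less_imp_le)
    finally show ?thesis by simp
  qed
  have "L2_set (\<lambda>x. norm (noise I (1\<^sup>2) f x - noise I 0 f x)) (signs I) \<le> c * (pi / 2 / sqrt (1 + m))"
  proof (rule tendsto_upperbound)
    have "isCont (\<lambda>b. L2_set (\<lambda>x. norm (noise I (b\<^sup>2) f x - noise I 0 f x)) (signs I)) 1"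
      unfolding L2_set_def noise_def kernel_def by (intro continuous_intros) simp_all
    then show "((\<lambda>b. L2_set (\<lambda>x. norm (noise I (b\<^sup>2) f x - noise I 0 f x)) (signs I))
        \<longlongrightarrow> L2_set (\<lambda>x. norm (noise I (1\<^sup>2) f x - noise I 0 f x)) (signs I)) (at_left 1)"
      unfolding isCont_def by (rule tendsto_within_subset) simp
    have "\<forall>\<^sub>F b in at_left 1. b \<in> {0<..<1::real}"
      by (rule eventually_at_left_real) simp
    then show "\<forall>\<^sub>F b in at_left 1. L2_set (\<lambda>x. norm (noise I (b\<^sup>2) f x - noise I 0 f x)) (signs I)
        \<le> c * (pi / 2 / sqrt (1 + m))"
      by eventually_elim (use near in auto)
  qed simp
  then have "sqrt (2 ^ card I * avg I (\<lambda>x. (norm (noise I 1 f x - noise I 0 f x))\<^sup>2)) \<le> c * (pi / 2 / sqrt (1 + m))"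
    by (simp add: L2_avg)
  then have "2 ^ card I * avg I (\<lambda>x. (norm (noise I 1 f x - noise I 0 f x))\<^sup>2) \<le> (c * (pi / 2 / sqrt (1 + m)))\<^sup>2"
    by (rule sqrt_le_D)
  also have "\<dots> = 2 ^ card I * (2 * pi\<^sup>2 * T\<^sup>2 / (1 + m) * A)"
    using A0 m0 by (simp add: c_def power_mult_distrib power_divide) (simp add: divide_simps algebra_simps)
  finally have "avg I (\<lambda>x. (norm (noise I 1 f x - noise I 0 f x))\<^sup>2) \<le> 2 * pi\<^sup>2 * T\<^sup>2 / (1 + m) * A"
    by (rule mult_left_le_imp_le) simp
  moreover have "avg I (\<lambda>x. (norm (noise I 1 f x - noise I 0 f x))\<^sup>2) = avg I (\<lambda>x. (norm (f x - noise I 0 f x))\<^sup>2)"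
    using assms by (intro avg_cong) (simp add: noise_one)
  ultimately show ?thesis by (simp add: m_def A_def)
qed

section \<open>From averages to the KKL inequality\<close>

lemma noise_zero_eq: "noise I 0 f x = noise I 0 f y"
  by (simp add: noise_def kernel_zero)

lemma norm_diff_square_le:
  fixes a b c :: "'a::real_normed_vector"
  shows "(norm (a - b))\<^sup>2 \<le> 2 * (norm (a - c))\<^sup>2 + 2 * (norm (b - c))\<^sup>2"
proof -
  have "norm (a - b) \<le> norm (a - c) + norm (b - c)"
    using norm_triangle_ineq4[of "a - c" "b - c"] by simp
  then have "(norm (a - b))\<^sup>2 \<le> (norm (a - c) + norm (b - c))\<^sup>2"
    by (rule power_mono) simp
  also have "\<dots> \<le> 2 * (norm (a - c))\<^sup>2 + 2 * (norm (b - c))\<^sup>2"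
    using sum_squares_bound[of "norm (a - c)" "norm (b - c)"] by (simp add: power2_sum)
  finally show ?thesis .
qed

lemma avg_avg_diff_square_le:
  fixes f :: "(nat \<Rightarrow> real) \<Rightarrow> 'a::real_normed_vector"
  assumes "finite I"
  shows "avg I (\<lambda>x. avg I (\<lambda>y. (norm (f x - f y))\<^sup>2)) \<le> 4 * avg I (\<lambda>x. (norm (f x - noise I 0 f x))\<^sup>2)"
proof -
  have "avg I (\<lambda>x. avg I (\<lambda>y. (norm (f x - f y))\<^sup>2))
      \<le> avg I (\<lambda>x. avg I (\<lambda>y. 2 * (norm (f x - noise I 0 f x))\<^sup>2 + 2 * (norm (f y - noise I 0 f y))\<^sup>2))"
    by (intro avg_mono) (metis norm_diff_square_le noise_zero_eq)
  also have "\<dots> = 4 * avg I (\<lambda>x. (norm (f x - noise I 0 f x))\<^sup>2)"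
    using assms by (simp add: avg_add avg_cmult avg_const)
  finally show ?thesis .
qed

lemma cube_eq_signs: "cube n = signs {1..n}"
  by (simp add: cube_def signs_def)

lemma finite_cube [simp]: "finite (cube n)"
  by (simp add: cube_eq_signs)

lemma cube_nonempty [simp]: "cube n \<noteq> {}"
  by (simp add: cube_def PiE_eq_empty_iff)

lemma card_cube: "card (cube n) = 2 ^ n"
  by (simp add: cube_eq_signs card_signs)

lemma expectation_cube: "measure_pmf.expectation (cube_pmf n) g = avg {1..n} g" for g :: "_ \<Rightarrow> real"
  by (simp add: cube_pmf_def integral_pmf_of_set avg_def card_cube) (simp add: cube_eq_signs)

lemma expectation_cube_pair:
  fixes g :: "(nat \<Rightarrow> real) \<Rightarrow> (nat \<Rightarrow> real) \<Rightarrow> real"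
  shows "measure_pmf.expectation (pair_pmf (cube_pmf n) (cube_pmf n)) (\<lambda>(x, y). g x y)
    = avg {1..n} (\<lambda>x. avg {1..n} (\<lambda>y. g x y))"
proof -
  have "measure_pmf.expectation (pair_pmf (cube_pmf n) (cube_pmf n)) (\<lambda>(x, y). g x y)
      = (\<Sum>p\<in>cube n \<times> cube n. (case p of (x, y) \<Rightarrow> g x y) * pmf (pair_pmf (cube_pmf n) (cube_pmf n)) p)"
    by (rule integral_measure_pmf_real) (auto simp: cube_pmf_def)
  also have "\<dots> = (\<Sum>x\<in>cube n. \<Sum>y\<in>cube n. g x y / (2 ^ n * 2 ^ n))"
    unfolding sum.cartesian_product
    by (rule sum.cong) (auto simp: pmf_pair cube_pmf_def card_cube)
  also have "\<dots> = avg {1..n} (\<lambda>x. avg {1..n} (\<lambda>y. g x y))"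
    by (simp add: avg_def cube_eq_signs sum_divide_distrib)
  finally show ?thesis .
qed

lemma edge_L1_eq:
  fixes f :: "(nat \<Rightarrow> real) \<Rightarrow> 'a::real_normed_vector"
  shows "edge_L1 n f j = 2 * avg {1..n} (\<lambda>x. norm (disc_deriv j f x))"
  by (simp add: edge_L1_def expectation_cube disc_deriv_def dist_norm flip: avg_cmult)

lemma edge_L2sq_eq:
  fixes f :: "(nat \<Rightarrow> real) \<Rightarrow> 'a::real_normed_vector"
  shows "edge_L2sq n f j = 4 * avg {1..n} (\<lambda>x. (norm (disc_deriv j f x))\<^sup>2)"
  by (simp add: edge_L2sq_def expectation_cube disc_deriv_def dist_norm power_divide flip: avg_cmult)

lemma type2_bound_iff: "type2_bound TYPE('a::real_normed_vector) T \<longleftrightarrow> (\<forall>n\<ge>1. type2_on TYPE('a) {1..n} T)"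
  by (simp add: type2_bound_def type2_on_def expectation_cube)

lemma edge_L2sq_nonneg: "0 \<le> edge_L2sq n f j"
  by (simp add: edge_L2sq_def expectation_cube avg_nonneg)

lemma edge_L1_le: "edge_L1 n f j \<le> sqrt (edge_L2sq n f j)"
proof (rule real_le_rsqrt)
  show "(edge_L1 n f j)\<^sup>2 \<le> edge_L2sq n f j"
    using avg_Cauchy_Schwarz[of "{1..n}" "\<lambda>_. 1" "\<lambda>x. dist (f x) (f (flip j x))"]
    by (simp add: edge_L1_def edge_L2sq_def expectation_cube avg_const)
qed

lemma edge_ratio_le_max:
  assumes "j \<in> {1..n}"
  shows "edge_L1 n f j \<le> max_edge_ratio n f * sqrt (edge_L2sq n f j)"
proof (cases "edge_L2sq n f j = 0")
  case True
  then show ?thesis using edge_L1_le[of n f j] by simp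
next
  case False
  have "edge_L1 n f j / sqrt (edge_L2sq n f j) \<le> max_edge_ratio n f"
    unfolding max_edge_ratio_def using assms by (intro Max_ge) auto
  then show ?thesis
    using False edge_L2sq_nonneg[of n f j] by (simp add: pos_divide_le_eq less_le)
qed

text \<open>
  Cauchy-Schwarz; the convention for \<open>0/0\<close> contributes the value \<open>0\<close>.
\<close>

lemma max_edge_ratio_le_one:
  assumes "n \<ge> 1"
  shows "max_edge_ratio n f \<le> 1"
  unfolding max_edge_ratio_def
proof (rule Max.boundedI)
  fix r assume "r \<in> (\<lambda>k. edge_L1 n f k / sqrt (edge_L2sq n f k)) ` {1..n}"
  then obtain k where "r = edge_L1 n f k / sqrt (edge_L2sq n f k)" by auto
  then show "r \<le> 1"
    using edge_L1_le[of n f k] edge_L2sq_nonneg[of n f k]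
    by (cases "edge_L2sq n f k = 0") (simp_all add: divide_le_eq_1)
qed (use assms in auto)

lemma deviation_le_of_type2:
  fixes f :: "(nat \<Rightarrow> real) \<Rightarrow> 'a::real_normed_vector"
  assumes "n \<ge> 1" "type2_bound TYPE('a) T" "0 \<le> T" "0 \<le> L"
    and L1: "\<And>j. j \<in> {1..n} \<Longrightarrow> edge_L1 n f j \<le> exp (- L) * sqrt (edge_L2sq n f j)"
  shows "avg {1..n} (\<lambda>x. avg {1..n} (\<lambda>y. (norm (f x - f y))\<^sup>2))
    \<le> 2 * pi\<^sup>2 * T\<^sup>2 / (1 + L / 8) * (\<Sum>j=1..n. edge_L2sq n f j)"
proof -
  let ?I = "{1..n}"
  have "avg ?I (\<lambda>x. avg ?I (\<lambda>y. (norm (f x - f y))\<^sup>2)) \<le> 4 * avg ?I (\<lambda>x. (norm (f x - noise ?I 0 f x))\<^sup>2)"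
    by (rule avg_avg_diff_square_le) simp
  also have "\<dots> \<le> 4 * (2 * pi\<^sup>2 * T\<^sup>2 / (1 + L / 8) * (\<Sum>i\<in>?I. avg ?I (\<lambda>x. (norm (disc_deriv i f x))\<^sup>2)))"
  proof (intro mult_left_mono L1_L2_influence_inequality)
    show "avg ?I (\<lambda>x. norm (disc_deriv i f x)) \<le> exp (- L) * sqrt (avg ?I (\<lambda>x. (norm (disc_deriv i f x))\<^sup>2))"
      if "i \<in> ?I" for i
      using L1[OF that] by (simp add: edge_L1_eq edge_L2sq_eq real_sqrt_mult)
  qed (use assms in \<open>auto simp: type2_bound_iff\<close>)
  also have "\<dots> = 2 * pi\<^sup>2 * T\<^sup>2 / (1 + L / 8) * (\<Sum>j=1..n. edge_L2sq n f j)"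
    by (simp add: edge_L2sq_eq mult_ac flip: sum_distrib_left)
  finally show ?thesis .
qed

lemma two_pi_le_exp_square: "2 * pi \<le> (exp 1)\<^sup>2"
proof -
  have "(2.6 :: real) \<le> exp 1"
    using e_approx_32 unfolding abs_le_iff by simp
  then have "(2.6 :: real)\<^sup>2 \<le> (exp 1)\<^sup>2" by (rule power_mono) simp
  moreover have "2 * pi \<le> (2.6 :: real)\<^sup>2"
    using pi_approx(2) by (simp add: power2_eq_square)
  ultimately show ?thesis by linarith
qed

text \<open>
  When the maximal ratio is positive, \<open>L = - ln r\<close> and \<open>1 + L / 8 \<ge> (1 + L) / 8\<close> leave the
  constant \<open>16 \<pi>\<^sup>2 \<le> 8 \<pi> e\<^sup>2 = (2 e \<surd>(2 \<pi>))\<^sup>2\<close>. When it is not, all edges have length zero, and the case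
  \<open>L = 0\<close> shows that the left-hand side vanishes too.
\<close>

lemma kkl_bound_of_type2_bound:
  assumes type2: "type2_bound TYPE('a::real_normed_vector) T" and T: "0 \<le> T"
  shows "kkl_bound TYPE('a) (2 * exp 1 * sqrt (2 * pi) * T)"
  unfolding kkl_bound_def
proof (intro allI impI)
  fix n :: nat and f :: "(nat \<Rightarrow> real) \<Rightarrow> 'a"
  assume n: "1 \<le> n"
  define S r where "S = (\<Sum>j=1..n. edge_L2sq n f j)" and "r = max_edge_ratio n f"
  define c :: real where "c = 2 * exp 1 * sqrt (2 * pi)"
  let ?lhs = "avg {1..n} (\<lambda>x. avg {1..n} (\<lambda>y. (norm (f x - f y))\<^sup>2))"
  have c2: "c\<^sup>2 = 8 * pi * (exp 1)\<^sup>2" by (simp add: c_def power_mult_distrib)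
  have S0: "0 \<le> S" by (simp add: S_def sum_nonneg edge_L2sq_nonneg)
  have "?lhs \<le> (c * T)\<^sup>2 / ln (exp 1 / r) * S"
  proof (cases "0 < r")
    case True
    define L where "L = - ln r"
    have r1: "r \<le> 1" unfolding r_def by (rule max_edge_ratio_le_one[OF n])
    have L0: "0 \<le> L" using True r1 by (simp add: L_def ln_le_zero_iff)
    have log: "ln (exp 1 / r) = 1 + L" using True by (simp add: L_def ln_div)
    have "?lhs \<le> 2 * pi\<^sup>2 * T\<^sup>2 / (1 + L / 8) * S"
      unfolding S_def
    proof (rule deviation_le_of_type2[OF n type2 T L0])
      fix j assume "j \<in> {1..n}"
      then show "edge_L1 n f j \<le> exp (- L) * sqrt (edge_L2sq n f j)"
        using edge_ratio_le_max[of j n f] True by (simp add: L_def r_def)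
    qed
    also have "\<dots> \<le> (c * T)\<^sup>2 / (1 + L) * S"
    proof (rule mult_right_mono[OF _ S0])
      have "2 * pi\<^sup>2 * T\<^sup>2 / (1 + L / 8) \<le> 2 * pi\<^sup>2 * T\<^sup>2 / ((1 + L) / 8)"
        using L0 by (intro divide_left_mono) auto
      also have "\<dots> = 8 * pi * (2 * pi) * T\<^sup>2 / (1 + L)"
        by (simp add: power2_eq_square)
      also have "\<dots> \<le> 8 * pi * (exp 1)\<^sup>2 * T\<^sup>2 / (1 + L)"
        using L0 two_pi_le_exp_square by (intro divide_right_mono mult_right_mono mult_left_mono) auto
      finally show "2 * pi\<^sup>2 * T\<^sup>2 / (1 + L / 8) \<le> (c * T)\<^sup>2 / (1 + L)"
        by (simp add: power_mult_distrib c2)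
    qed
    finally show ?thesis by (simp only: log)
  next
    case False
    have edge0: "edge_L2sq n f j = 0" if j: "j \<in> {1..n}" for j
    proof -
      have "edge_L1 n f j \<le> r * sqrt (edge_L2sq n f j)"
        unfolding r_def by (rule edge_ratio_le_max[OF j])
      also have "\<dots> \<le> 0"
        using False edge_L2sq_nonneg[of n f j] by (intro mult_nonpos_nonneg) auto
      finally have "avg {1..n} (\<lambda>x. norm (disc_deriv j f x)) \<le> 0"
        by (simp add: edge_L1_eq)
      then have "(\<Sum>x\<in>signs {1..n}. norm (disc_deriv j f x)) = 0"
        by (intro antisym) (auto simp: avg_def pos_divide_le_eq sum_nonneg)
      then have "\<forall>x\<in>signs {1..n}. norm (disc_deriv j f x) = 0"
        by (subst (asm) sum_nonneg_eq_0_iff) auto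
      then show ?thesis
        by (simp add: edge_L2sq_eq avg_def)
    qed
    have "?lhs \<le> 2 * pi\<^sup>2 * T\<^sup>2 / (1 + 0 / 8) * S"
      unfolding S_def
    proof (rule deviation_le_of_type2[OF n type2 T])
      show "edge_L1 n f j \<le> exp (- 0) * sqrt (edge_L2sq n f j)" for j
        using edge_L1_le[of n f j] by simp
    qed simp
    moreover have "S = 0" using edge0 by (simp add: S_def)
    ultimately show ?thesis by simp
  qed
  then show "measure_pmf.expectation (pair_pmf (cube_pmf n) (cube_pmf n)) (\<lambda>(x, y). (dist (f x) (f y))\<^sup>2)
      \<le> (2 * exp 1 * sqrt (2 * pi) * T)\<^sup>2 / ln (exp 1 / max_edge_ratio n f) * (\<Sum>j=1..n. edge_L2sq n f j)"
    unfolding expectation_cube_pair by (simp only: dist_norm c_def S_def r_def)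
qed

text \<open>
  The inequality for the linear map \<open>f \<epsilon> = (\<Sum>j. \<epsilon>\<^sub>j v\<^sub>j)\<close>. Its mean is zero, so \<open>f x\<close> is the mean of
  \<open>f x - f y\<close> over \<open>y\<close>, and Jensen compares the two left-hand sides.
\<close>

lemma type2_bound_of_kkl_bound:
  assumes kkl: "kkl_bound TYPE('a::real_normed_vector) T"
  shows "type2_bound TYPE('a) (2 * T)"
  unfolding type2_bound_def
proof (intro allI impI)
  fix n :: nat and v :: "nat \<Rightarrow> 'a"
  assume n: "1 \<le> n"
  let ?I = "{1..n}"
  define f where "f = (\<lambda>\<epsilon>. \<Sum>j=1..n. \<epsilon> j *\<^sub>R v j)"
  have edge: "f \<epsilon> - f (flip j \<epsilon>) = (2 * \<epsilon> j) *\<^sub>R v j" if "j \<in> ?I" for \<epsilon> j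
  proof -
    have "f \<epsilon> - f (flip j \<epsilon>) = (\<Sum>i\<in>?I. if i = j then (2 * \<epsilon> j) *\<^sub>R v j else 0)"
      unfolding f_def sum_subtractf[symmetric]
      by (rule sum.cong) (auto simp: flip_def scaleR_2 simp flip: scaleR_scaleR)
    then show ?thesis using that by simp
  qed
  have L1: "edge_L1 n f j = 2 * norm (v j)" and L2: "edge_L2sq n f j = 4 * (norm (v j))\<^sup>2" if j: "j \<in> ?I" for j
  proof -
    have d: "dist (f \<epsilon>) (f (flip j \<epsilon>)) = 2 * norm (v j)" if "\<epsilon> \<in> signs ?I" for \<epsilon>
      using signs_cases[OF that j] by (auto simp: dist_norm edge[OF j])
    have "edge_L1 n f j = avg ?I (\<lambda>_. 2 * norm (v j))"
      unfolding edge_L1_def expectation_cube by (rule avg_cong) (rule d)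
    then show "edge_L1 n f j = 2 * norm (v j)" by (simp add: avg_const)
    have "edge_L2sq n f j = avg ?I (\<lambda>_. (2 * norm (v j))\<^sup>2)"
      unfolding edge_L2sq_def expectation_cube by (rule avg_cong) (simp add: d)
    then show "edge_L2sq n f j = 4 * (norm (v j))\<^sup>2" by (simp add: avg_const power_mult_distrib)
  qed
  have "avg ?I (\<lambda>\<epsilon>. (norm (f \<epsilon>))\<^sup>2) \<le> (2 * T)\<^sup>2 * (\<Sum>j=1..n. (norm (v j))\<^sup>2)"
  proof (cases "\<forall>j\<in>?I. v j = 0")
    case True
    then have "f \<epsilon> = 0" for \<epsilon> by (simp add: f_def)
    then show ?thesis using True by (simp add: avg_def)
  next
    case False
    then obtain k where k: "k \<in> ?I" "v k \<noteq> 0" by auto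
    have ratio: "edge_L1 n f j / sqrt (edge_L2sq n f j) = (if v j = 0 then 0 else 1)" if "j \<in> ?I" for j
      using that by (simp add: L1 L2 real_sqrt_mult)
    have "max_edge_ratio n f = 1"
    proof (rule antisym[OF max_edge_ratio_le_one[OF n]])
      have "1 = edge_L1 n f k / sqrt (edge_L2sq n f k)" using ratio k by simp
      also have "\<dots> \<le> max_edge_ratio n f"
        unfolding max_edge_ratio_def using k by (intro Max_ge) auto
      finally show "1 \<le> max_edge_ratio n f" .
    qed
    have "\<not> f constant_on cube n"
    proof
      assume "f constant_on cube n"
      then obtain c where c: "\<And>x. x \<in> signs ?I \<Longrightarrow> f x = c"
        unfolding constant_on_def cube_eq_signs by auto
      obtain \<epsilon> where \<epsilon>: "\<epsilon> \<in> signs ?I" using cube_nonempty[of n] by (auto simp: cube_eq_signs)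
      have "(2 * \<epsilon> k) *\<^sub>R v k = 0"
        using edge[OF k(1), of \<epsilon>] c \<epsilon> flip_in_signs[OF k(1) \<epsilon>] by simp
      with k signs_cases[OF \<epsilon> k(1)] show False by auto
    qed
    with kkl n have "avg ?I (\<lambda>x. avg ?I (\<lambda>y. (dist (f x) (f y))\<^sup>2))
        \<le> T\<^sup>2 / ln (exp 1 / max_edge_ratio n f) * (\<Sum>j=1..n. edge_L2sq n f j)"
      unfolding kkl_bound_def expectation_cube_pair by blast
    also have "\<dots> = (2 * T)\<^sup>2 * (\<Sum>j=1..n. (norm (v j))\<^sup>2)"
      by (simp add: \<open>max_edge_ratio n f = 1\<close> L2 power_mult_distrib sum_distrib_left mult_ac)
    finally have kkl_f: "avg ?I (\<lambda>x. avg ?I (\<lambda>y. (dist (f x) (f y))\<^sup>2)) \<le> (2 * T)\<^sup>2 * (\<Sum>j=1..n. (norm (v j))\<^sup>2)" .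
    have mean: "(\<Sum>y\<in>signs ?I. (1 / 2 ^ n) *\<^sub>R f y) = 0"
    proof -
      have "(\<Sum>y\<in>signs ?I. (1 / 2 ^ n) *\<^sub>R f y) = (\<Sum>i\<in>?I. (\<Sum>y\<in>signs ?I. kernel ?I 0 y y * y i) *\<^sub>R v i)"
        unfolding f_def scaleR_sum_right scaleR_sum_left
        by (subst sum.swap) (simp add: kernel_zero)
      \<comment> \<open>At \<open>\<rho> = 0\<close> the kernel is the uniform law, under which every coordinate has mean \<open>0\<close>.\<close>
      also have "\<dots> = 0"
      proof (intro sum.neutral ballI)
        fix i assume i: "i \<in> ?I"
        obtain \<epsilon> where "\<epsilon> \<in> signs ?I" using cube_nonempty[of n] by (auto simp: cube_eq_signs)
        then show "(\<Sum>y\<in>signs ?I. kernel ?I 0 y y * y i) *\<^sub>R v i = 0"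
          using sum_kernel_coordinate[OF _ i, of \<epsilon> 0] by (simp add: kernel_zero)
      qed
      finally show ?thesis .
    qed
    have "(norm (f x))\<^sup>2 \<le> avg ?I (\<lambda>y. (dist (f x) (f y))\<^sup>2)" for x
    proof -
      have one: "(\<Sum>y\<in>signs ?I. 1 / 2 ^ n) = (1 :: real)" by (simp add: card_signs)
      have "f x = (\<Sum>y\<in>signs ?I. (1 / 2 ^ n) *\<^sub>R (f x - f y))"
        by (simp only: scaleR_diff_right sum_subtractf mean one scaleR_one diff_zero flip: scaleR_sum_left)
      also have "(norm \<dots>)\<^sup>2 \<le> (\<Sum>y\<in>signs ?I. 1 / 2 ^ n * (norm (f x - f y))\<^sup>2)"
        by (rule norm_convex_combination_square_le) (use one in auto)
      finally show ?thesis by (simp add: avg_def dist_norm sum_divide_distrib)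
    qed
    then have "avg ?I (\<lambda>x. (norm (f x))\<^sup>2) \<le> avg ?I (\<lambda>x. avg ?I (\<lambda>y. (dist (f x) (f y))\<^sup>2))"
      by (intro avg_mono)
    with kkl_f show ?thesis by linarith
  qed
  then show "measure_pmf.expectation (cube_pmf n) (\<lambda>\<epsilon>. (norm (\<Sum>j=1..n. \<epsilon> j *\<^sub>R v j))\<^sup>2)
      \<le> (2 * T)\<^sup>2 * (\<Sum>j=1..n. (norm (v j))\<^sup>2)"
    by (simp only: expectation_cube f_def)
qed

theorem theorem1:
  "T2 TYPE('a::real_normed_vector) / 2 \<le> T_KKL TYPE('a) \<and>
   T_KKL TYPE('a) \<le> ennreal (2 * exp 1 * sqrt (2 * pi)) * T2 TYPE('a)"
proof
  show "T2 TYPE('a) / 2 \<le> T_KKL TYPE('a)"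
    unfolding T_KKL_def
  proof (rule Inf_greatest, clarify)
    fix T :: real assume T: "0 \<le> T" "kkl_bound TYPE('a) T"
    have "T2 TYPE('a) \<le> ennreal (2 * T)"
      unfolding T2_def using T type2_bound_of_kkl_bound by (intro Inf_lower CollectI exI[of _ "2 * T"]) auto
    then have "T2 TYPE('a) / 2 \<le> ennreal (2 * T) / 2"
      by (rule divide_right_mono_ennreal)
    also have "\<dots> = ennreal T"
      using T divide_ennreal[of "2 * T" 2] by simp
    finally show "T2 TYPE('a) / 2 \<le> ennreal T" .
  qed
next
  define c :: real where "c = 2 * exp 1 * sqrt (2 * pi)"
  have c: "0 < c" by (simp add: c_def)
  have "T_KKL TYPE('a) / ennreal c \<le> T2 TYPE('a)"
    unfolding T2_def
  proof (rule Inf_greatest, clarify)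
    fix T :: real assume T: "0 \<le> T" "type2_bound TYPE('a) T"
    have "T_KKL TYPE('a) \<le> ennreal (c * T)"
      unfolding T_KKL_def c_def using T kkl_bound_of_type2_bound
      by (intro Inf_lower CollectI exI[of _ "2 * exp 1 * sqrt (2 * pi) * T"]) auto
    then have "T_KKL TYPE('a) / ennreal c \<le> ennreal (c * T) / ennreal c"
      by (rule divide_right_mono_ennreal)
    also have "\<dots> = ennreal T"
      using T c by (simp add: divide_ennreal)
    finally show "T_KKL TYPE('a) / ennreal c \<le> ennreal T" .
  qed
  then have "ennreal c * (T_KKL TYPE('a) / ennreal c) \<le> ennreal c * T2 TYPE('a)"
    by (rule mult_left_mono) simp
  moreover have "ennreal c * (T_KKL TYPE('a) / ennreal c) = T_KKL TYPE('a)"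
    using c by (simp add: ennreal_times_divide mult.commute[of "ennreal c"] mult_divide_eq_ennreal)
  ultimately show "T_KKL TYPE('a) \<le> ennreal (2 * exp 1 * sqrt (2 * pi)) * T2 TYPE('a)"
    by (simp add: c_def)
qed

end
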